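(* For every $r\in(1,1.2)$ and every sufficiently large $N$, there exists a connected, undirected, edge-weighted graph $A_N$ on $N$ nodes such that \[ \rho^{\mathrm{Bd}}_r(A_N)>1.04\cdot\rho^{\mathrm{Bd}}_r(K_N)\quad\text{and}\quad \rho^{\mathrm{dB}}_r(A_N)>1.04\cdot\rho^{\mathrm{dB}}_r(K_N). \]
   Context: Each edge $\{u,v\}$ has a positive weight $w(u,v)$ and $\deg(u)=\sum_v w(u,v)$. Each node is occupied by a resident (fitness 1) or a mutant (fitness $r\ge1$); $f(u)$ is the fitness at $u$, $F=\sum_u f(u)$. Moran Birth-death (Bd) process: each step a node $u$ is chosen with probability $f(u)/F$ and its offspring replaces a neighbor $v$ chosen with probability $w(u,v)/\deg(u)$. Moran death-Birth (dB) process: each step a uniformly random node $v$ dies and is replaced by the offspring of a neighbor $u$ chosen with probability $f(u)w(u,v)/\sum_{u'}f(u')w(u',v)$. For a graph $G_N$ and process $p$, $\rho^p_r(G_N)=\frac1N\sum_{v}\rho^p_r(G_N,\{v\})$, where $\rho^p_r(G_N,\{v\})$ is the probability that mutants eventually occupy all nodes when initially only $v$ is a mutant. $K_N$ is the unweighted complete graph on $N$ nodes, for which $\rho^{\mathrm{Bd}}_r(K_N)=\frac{1-1/r}{1-1/r^N}$ and $\rho^{\mathrm{dB}}_r(K_N)=\frac{N-1}{N}\cdot\frac{1-1/r}{1-1/r^{N-1}}$. *)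

theory Defs
  imports Complex_Main
begin

text \<open>Graphs on the node set {0..<N}; w u v is the weight of edge {u,v} (0 = no edge).\<close>

definition wgraph :: "nat \<Rightarrow> (nat \<Rightarrow> nat \<Rightarrow> real) \<Rightarrow> bool" where
  "wgraph N w \<longleftrightarrow>
     (\<forall>u v. w u v = w v u) \<and> (\<forall>u v. 0 \<le> w u v) \<and> (\<forall>u. w u u = 0)"

definition connected_wgraph :: "nat \<Rightarrow> (nat \<Rightarrow> nat \<Rightarrow> real) \<Rightarrow> bool" where
  "connected_wgraph N w \<longleftrightarrow> wgraph N w \<and>
     (\<forall>u<N. \<forall>v<N. (\<lambda>a b. a < N \<and> b < N \<and> 0 < w a b)\<^sup>*\<^sup>* u v)"

definition complete_graph :: "nat \<Rightarrow> nat \<Rightarrow> real" where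
  "complete_graph u v = (if u = v then 0 else 1)"

definition fit :: "real \<Rightarrow> nat set \<Rightarrow> nat \<Rightarrow> real" where
  "fit r S u = (if u \<in> S then r else 1)"

definition wdeg :: "nat \<Rightarrow> (nat \<Rightarrow> nat \<Rightarrow> real) \<Rightarrow> nat \<Rightarrow> real" where
  "wdeg N w u = (\<Sum>v<N. w u v)"

text \<open>New mutant set after the offspring of u replaces v.\<close>
definition replace :: "nat set \<Rightarrow> nat \<Rightarrow> nat \<Rightarrow> nat set" where
  "replace S u v = (if u \<in> S then insert v S else S - {v})"

text \<open>One-step expectation operators (h evaluated at the successor state).\<close>
definition Bd_step :: "nat \<Rightarrow> (nat \<Rightarrow> nat \<Rightarrow> real) \<Rightarrow> real \<Rightarrow> (nat set \<Rightarrow> real) \<Rightarrow> nat set \<Rightarrow> real" where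
  "Bd_step N w r h S = (\<Sum>u<N. \<Sum>v<N.
      (fit r S u / (\<Sum>x<N. fit r S x)) * (w u v / wdeg N w u) * h (replace S u v))"

definition dB_step :: "nat \<Rightarrow> (nat \<Rightarrow> nat \<Rightarrow> real) \<Rightarrow> real \<Rightarrow> (nat set \<Rightarrow> real) \<Rightarrow> nat set \<Rightarrow> real" where
  "dB_step N w r h S = (\<Sum>v<N. \<Sum>u<N.
      (1 / real N) * (fit r S u * w u v / (\<Sum>x<N. fit r S x * w x v)) * h (replace S u v))"

fun absorb_within :: "((nat set \<Rightarrow> real) \<Rightarrow> nat set \<Rightarrow> real) \<Rightarrow> nat \<Rightarrow> nat \<Rightarrow> nat set \<Rightarrow> real" where
  "absorb_within step N 0 S = (if S = {..<N} then 1 else 0)"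
| "absorb_within step N (Suc n) S =
     (if S = {..<N} then 1 else step (absorb_within step N n) S)"

definition fixation :: "((nat set \<Rightarrow> real) \<Rightarrow> nat set \<Rightarrow> real) \<Rightarrow> nat \<Rightarrow> nat set \<Rightarrow> real" where
  "fixation step N S = (SUP n. absorb_within step N n S)"

definition rho :: "((nat set \<Rightarrow> real) \<Rightarrow> nat set \<Rightarrow> real) \<Rightarrow> nat \<Rightarrow> real" where
  "rho step N = (1 / real N) * (\<Sum>v<N. fixation step N {v})"

definition rho_Bd :: "real \<Rightarrow> nat \<Rightarrow> (nat \<Rightarrow> nat \<Rightarrow> real) \<Rightarrow> real" where
  "rho_Bd r N w = rho (Bd_step N w r) N"

definition rho_dB :: "real \<Rightarrow> nat \<Rightarrow> (nat \<Rightarrow> nat \<Rightarrow> real) \<Rightarrow> real" where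
  "rho_dB r N w = rho (dB_step N w r) N"

end

theory Submission
  imports Defs
begin

text \<open>
  The graph consists of a clique (the hub) holding 4 percent of the nodes and of pairs of nodes
  joined by an edge of weight \<open>W\<close> (one half of the pairs) or \<open>1 / W\<close> (the other half). Every pair
  node is joined to every hub node by an edge of weight \<open>\<epsilon>\<close>, with \<open>\<epsilon>\<close> tending to 0 for fixed \<open>N\<close>.
  In the limit each module (hub or pair) becomes homogeneous between two migrations. Under dB
  updating a heavy pair invades the hub much more often than the hub invades it; under Bd updating
  the light pairs have this property. A mutant in such a pair takes over the pair with probability
  at least 1/2, and then sends migrants to the hub until one of them takes over the hub. Resident
  migrants retake a mutant hub only with exponentially small probability, so the mutants then win.
  Hence both fixation probabilities are close to 1/4, more than \<open>1.04 * (1 - 1 / r)\<close>, which is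
  below 0.174.

  The bound is obtained from a potential that is a strict submartingale for small \<open>\<epsilon>\<close>. It is affine in
  the state of each module. States with a mixed module already have positive drift at \<open>\<epsilon> = 0\<close>;
  in the other states the drift is of order \<open>\<epsilon>\<close> and its leading coefficient is positive.
\<close>

definition edge_chain ::
    "nat \<Rightarrow> ((nat set \<Rightarrow> real) \<Rightarrow> nat set \<Rightarrow> real) \<Rightarrow> (nat set \<Rightarrow> nat \<Rightarrow> nat \<Rightarrow> real) \<Rightarrow> bool" where
  "edge_chain N step P \<longleftrightarrow>
     (\<forall>S\<subseteq>{..<N}. (\<forall>h. step h S = (\<Sum>u<N. \<Sum>v<N. P S u v * h (replace S u v))) \<and>
        (\<forall>u<N. \<forall>v<N. 0 \<le> P S u v) \<and> (\<Sum>u<N. \<Sum>v<N. P S u v) = 1)"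

lemma replace_subset: "S \<subseteq> {..<N} \<Longrightarrow> v < N \<Longrightarrow> replace S u v \<subseteq> {..<N}"
  by (auto simp: replace_def)

context
  fixes N :: nat and step :: "(nat set \<Rightarrow> real) \<Rightarrow> nat set \<Rightarrow> real" and P :: "nat set \<Rightarrow> nat \<Rightarrow> nat \<Rightarrow> real"
  assumes chain: "edge_chain N step P"
begin

lemma step_eq: "S \<subseteq> {..<N} \<Longrightarrow> step h S = (\<Sum>u<N. \<Sum>v<N. P S u v * h (replace S u v))"
  and P_nonneg: "S \<subseteq> {..<N} \<Longrightarrow> u < N \<Longrightarrow> v < N \<Longrightarrow> 0 \<le> P S u v"
  and P_total: "S \<subseteq> {..<N} \<Longrightarrow> (\<Sum>u<N. \<Sum>v<N. P S u v) = 1"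
  using chain by (auto simp: edge_chain_def)

lemma step_mono:
  assumes "S \<subseteq> {..<N}" "\<And>T. T \<subseteq> {..<N} \<Longrightarrow> g T \<le> h T"
  shows "step g S \<le> step h S"
  unfolding step_eq[OF assms(1)]
  by (intro sum_mono mult_left_mono assms(2) replace_subset P_nonneg assms(1)) auto

lemma step_const: "S \<subseteq> {..<N} \<Longrightarrow> step (\<lambda>_. c) S = c"
  using P_total[of S] by (simp add: step_eq flip: sum_distrib_right)

lemma step_diff: "S \<subseteq> {..<N} \<Longrightarrow> step (\<lambda>T. g T - h T) S = step g S - step h S"
  by (simp add: step_eq right_diff_distrib sum_subtractf)

lemma absorb_within_range:
  "S \<subseteq> {..<N} \<Longrightarrow> 0 \<le> absorb_within step N n S \<and> absorb_within step N n S \<le> 1"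
proof (induction n arbitrary: S)
  case (Suc n)
  have "step (\<lambda>_. 0) S \<le> step (absorb_within step N n) S"
       "step (absorb_within step N n) S \<le> step (\<lambda>_. 1) S"
    using Suc by (auto intro!: step_mono)
  then show ?case using Suc.prems by (simp add: step_const)
qed simp

lemma absorb_within_Suc_ge:
  "S \<subseteq> {..<N} \<Longrightarrow> absorb_within step N n S \<le> absorb_within step N (Suc n) S"
proof (induction n arbitrary: S)
  case 0
  then show ?case using absorb_within_range[OF 0, of "Suc 0"] by (cases "S = {..<N}") auto
next
  case (Suc n)
  then have "step (absorb_within step N n) S \<le> step (absorb_within step N (Suc n)) S"
    by (intro step_mono) auto
  then show ?case by simp
qed

lemma absorb_within_tendsto_fixation:
  assumes "S \<subseteq> {..<N}"
  shows "(\<lambda>n. absorb_within step N n S) \<longlonglongrightarrow> fixation step N S"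
  unfolding fixation_def
proof (rule LIMSEQ_incseq_SUP)
  show "bdd_above (range (\<lambda>n. absorb_within step N n S))"
    using absorb_within_range[OF assms] by (intro bdd_aboveI[of _ 1]) auto
  show "incseq (\<lambda>n. absorb_within step N n S)"
    using absorb_within_Suc_ge[OF assms] by (rule incseq_SucI)
qed

lemma fixation_nonneg: "S \<subseteq> {..<N} \<Longrightarrow> 0 \<le> fixation step N S"
  using LIMSEQ_le_const[OF absorb_within_tendsto_fixation, of S 0] absorb_within_range by blast

lemma fixation_full: "fixation step N {..<N} = 1"
proof -
  have "absorb_within step N n {..<N} = 1" for n by (cases n) auto
  then show ?thesis by (simp add: fixation_def)
qed

lemma fixation_harmonic:
  assumes "S \<subseteq> {..<N}" "S \<noteq> {..<N}"
  shows "fixation step N S = step (fixation step N) S"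
proof (rule LIMSEQ_unique)
  show "(\<lambda>n. absorb_within step N (Suc n) S) \<longlonglongrightarrow> fixation step N S"
    using absorb_within_tendsto_fixation[OF assms(1)] by (rule LIMSEQ_Suc)
  have "(\<lambda>n. \<Sum>u<N. \<Sum>v<N. P S u v * absorb_within step N n (replace S u v))
      \<longlonglongrightarrow> (\<Sum>u<N. \<Sum>v<N. P S u v * fixation step N (replace S u v))"
    using assms(1)
    by (intro tendsto_sum tendsto_mult tendsto_const absorb_within_tendsto_fixation replace_subset) auto
  then show "(\<lambda>n. absorb_within step N (Suc n) S) \<longlonglongrightarrow> step (fixation step N) S"
    using assms by (simp add: step_eq)
qed

lemma fixation_ge_strict_submartingale:
  assumes empty: "h {} \<le> 0" and full: "h {..<N} \<le> 1"
    and sub: "\<And>S. S \<subseteq> {..<N} \<Longrightarrow> S \<noteq> {} \<Longrightarrow> S \<noteq> {..<N} \<Longrightarrow> h S < step h S"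
    and S: "S \<subseteq> {..<N}"
  shows "h S \<le> fixation step N S"
proof -
  define d where "d T = h T - fixation step N T" for T
  have "Max (d ` Pow {..<N}) \<in> d ` Pow {..<N}" by (rule Max_in) auto
  then obtain T where T: "T \<subseteq> {..<N}" and dT: "d T = Max (d ` Pow {..<N})" by auto
  have max: "d U \<le> d T" if "U \<subseteq> {..<N}" for U
    unfolding dT using that by (intro Max_ge) auto
  have "T = {} \<or> T = {..<N}"
  proof (rule ccontr)
    assume *: "\<not> ?thesis"
    have "d T < step d T"
      using sub[OF T] fixation_harmonic[OF T] * step_diff[OF T, of h "fixation step N"]
      by (simp add: d_def[abs_def])
    also have "\<dots> \<le> step (\<lambda>_. d T) T" using T max by (intro step_mono) auto
    finally show False by (simp add: step_const[OF T])
  qed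
  then have "d T \<le> 0"
    using empty full fixation_nonneg[of "{}"] fixation_full by (auto simp: d_def)
  then show ?thesis using max[OF S] by (simp add: d_def)
qed

lemma fixation_le_supermartingale:
  assumes nonneg: "\<And>S. S \<subseteq> {..<N} \<Longrightarrow> 0 \<le> h S" and full: "1 \<le> h {..<N}"
    and super: "\<And>S. S \<subseteq> {..<N} \<Longrightarrow> step h S \<le> h S"
    and S: "S \<subseteq> {..<N}"
  shows "fixation step N S \<le> h S"
proof -
  have "T \<subseteq> {..<N} \<Longrightarrow> absorb_within step N n T \<le> h T" for n T
  proof (induction n arbitrary: T)
    case (Suc n)
    then have "step (absorb_within step N n) T \<le> step h T" by (intro step_mono) auto
    with super[OF Suc.prems] full show ?case by auto
  qed (use nonneg full in auto)
  then show ?thesis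
    using LIMSEQ_le_const2[OF absorb_within_tendsto_fixation[OF S]] S by blast
qed

lemma step_minus: "S \<subseteq> {..<N} \<Longrightarrow> step h S - h S = (\<Sum>u<N. \<Sum>v<N. P S u v * (h (replace S u v) - h S))"
  using P_total[of S] by (simp add: step_eq right_diff_distrib sum_subtractf flip: sum_distrib_right)

end

definition Bd_coeff :: "nat \<Rightarrow> real \<Rightarrow> (nat \<Rightarrow> nat \<Rightarrow> real) \<Rightarrow> nat set \<Rightarrow> nat \<Rightarrow> nat \<Rightarrow> real" where
  "Bd_coeff N r w S u v = fit r S u / ((\<Sum>x<N. fit r S x) * wdeg N w u)"

definition dB_coeff :: "nat \<Rightarrow> real \<Rightarrow> (nat \<Rightarrow> nat \<Rightarrow> real) \<Rightarrow> nat set \<Rightarrow> nat \<Rightarrow> nat \<Rightarrow> real" where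
  "dB_coeff N r w S u v = fit r S u / (real N * (\<Sum>x<N. fit r S x * w x v))"

lemma fit_pos: "0 < r \<Longrightarrow> 0 < fit r S u"
  by (simp add: fit_def)

lemma fit_sum_pos: "0 < r \<Longrightarrow> 0 < N \<Longrightarrow> 0 < (\<Sum>x<N. fit r S x)"
  by (intro sum_pos) (auto simp: fit_pos)

lemma fit_weight_sum_pos:
  assumes "0 < r" "wgraph N w" "0 < wdeg N w v"
  shows "0 < (\<Sum>x<N. fit r S x * w x v)"
proof -
  have nn: "0 \<le> w v x" and sym: "w x v = w v x" for x using assms by (auto simp: wgraph_def)
  have "\<exists>x<N. 0 < w v x"
  proof (rule ccontr)
    assume "\<not> ?thesis"
    then have "(\<Sum>x<N. w v x) \<le> 0" by (intro sum_nonpos) force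
    then show False using assms by (simp add: wdeg_def)
  qed
  then obtain x where x: "x < N" "0 < w v x" by blast
  then have "0 < fit r S x * w x v" using assms sym by (simp add: fit_pos)
  then show ?thesis
    using x assms(1) nn sym by (intro sum_pos2[of _ x]) (auto simp: fit_pos less_imp_le)
qed

lemma edge_chain_Bd:
  assumes "0 < r" "0 < N" "wgraph N w" and deg: "\<And>u. u < N \<Longrightarrow> 0 < wdeg N w u"
  shows "edge_chain N (Bd_step N w r) (\<lambda>S u v. Bd_coeff N r w S u v * w u v)"
  unfolding edge_chain_def
proof (intro allI impI conjI)
  fix S :: "nat set"
  have F: "0 < (\<Sum>x<N. fit r S x)" using assms by (simp add: fit_sum_pos)
  show "Bd_step N w r h S = (\<Sum>u<N. \<Sum>v<N. Bd_coeff N r w S u v * w u v * h (replace S u v))" for h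
    by (simp add: Bd_step_def Bd_coeff_def)
  show "0 \<le> Bd_coeff N r w S u v * w u v" if "u < N" for u v
    using that F deg[of u] assms by (simp add: Bd_coeff_def fit_pos less_imp_le wgraph_def)
  have "(\<Sum>v<N. Bd_coeff N r w S u v * w u v) = fit r S u / (\<Sum>x<N. fit r S x)" if "u < N" for u
  proof -
    have "(\<Sum>v<N. Bd_coeff N r w S u v * w u v)
        = fit r S u / ((\<Sum>x<N. fit r S x) * wdeg N w u) * wdeg N w u"
      by (simp only: Bd_coeff_def wdeg_def sum_distrib_left)
    then show ?thesis using deg[OF that] by simp
  qed
  then show "(\<Sum>u<N. \<Sum>v<N. Bd_coeff N r w S u v * w u v) = 1"
    using F by (simp flip: sum_divide_distrib)
qed

lemma edge_chain_dB:
  assumes "0 < r" "0 < N" "wgraph N w" and deg: "\<And>u. u < N \<Longrightarrow> 0 < wdeg N w u"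
  shows "edge_chain N (dB_step N w r) (\<lambda>S u v. dB_coeff N r w S u v * w u v)"
  unfolding edge_chain_def
proof (intro allI impI conjI)
  fix S :: "nat set"
  have Z: "0 < (\<Sum>x<N. fit r S x * w x v)" if "v < N" for v
    using fit_weight_sum_pos[OF assms(1,3) deg[OF that]] .
  show "dB_step N w r h S = (\<Sum>u<N. \<Sum>v<N. dB_coeff N r w S u v * w u v * h (replace S u v))" for h
    unfolding dB_step_def by (subst sum.swap) (simp add: dB_coeff_def)
  show "0 \<le> dB_coeff N r w S u v * w u v" if "v < N" for u v
    using that Z[of v] assms by (simp add: dB_coeff_def fit_pos less_imp_le wgraph_def)
  have "(\<Sum>u<N. dB_coeff N r w S u v * w u v) = 1 / real N" if "v < N" for v
  proof -
    have "(\<Sum>u<N. dB_coeff N r w S u v * w u v)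
        = (\<Sum>u<N. fit r S u * w u v) / (real N * (\<Sum>x<N. fit r S x * w x v))"
      by (simp add: dB_coeff_def sum_divide_distrib)
    then show ?thesis using Z[OF that] by simp
  qed
  then show "(\<Sum>u<N. \<Sum>v<N. dB_coeff N r w S u v * w u v) = 1"
    using assms(2) by (subst sum.swap) simp
qed

text \<open>Pairing the two directions of each edge reduces the sign of a drift to edgewise inequalities.\<close>

lemma edge_sum_symmetrize:
  fixes c w :: "nat \<Rightarrow> nat \<Rightarrow> real"
  assumes sym: "\<And>u v. w u v = w v u"
  shows "2 * (\<Sum>u<N. \<Sum>v<N. c u v * w u v * d u v)
       = (\<Sum>u<N. \<Sum>v<N. w u v * (c u v * d u v + c v u * d v u))"
proof -
  have "(\<Sum>u<N. \<Sum>v<N. c u v * w u v * d u v) = (\<Sum>u<N. \<Sum>v<N. c v u * w u v * d v u)"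
    by (subst sum.swap) (simp only: sym)
  then have "2 * (\<Sum>u<N. \<Sum>v<N. c u v * w u v * d u v)
      = (\<Sum>u<N. \<Sum>v<N. c u v * w u v * d u v) + (\<Sum>u<N. \<Sum>v<N. c v u * w u v * d v u)"
    by linarith
  also have "\<dots> = (\<Sum>u<N. \<Sum>v<N. w u v * (c u v * d u v + c v u * d v u))"
    by (simp add: sum.distrib[symmetric] distrib_left mult_ac)
  finally show ?thesis .
qed

lemma replace_same: "(u \<in> S \<longleftrightarrow> v \<in> S) \<Longrightarrow> replace S u v = S"
  by (auto simp: replace_def)

lemma edge_sum_nonneg:
  fixes c w :: "nat \<Rightarrow> nat \<Rightarrow> real"
  assumes sym: "\<And>u v. w u v = w v u" and nn: "\<And>u v. 0 \<le> w u v"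
    and mixed: "\<And>u v. u < N \<Longrightarrow> v < N \<Longrightarrow> u \<in> S \<Longrightarrow> v \<notin> S \<Longrightarrow> 0 < w u v \<Longrightarrow>
       0 \<le> c u v * (h (replace S u v) - h S) + c v u * (h (replace S v u) - h S)"
    and uv: "u < N" "v < N"
  shows "0 \<le> w u v * (c u v * (h (replace S u v) - h S) + c v u * (h (replace S v u) - h S))"
proof (cases "w u v = 0 \<or> (u \<in> S \<longleftrightarrow> v \<in> S)")
  case True
  then show ?thesis by (auto simp: replace_same)
next
  case False
  then have "0 < w u v" "0 < w v u" using nn[of u v] sym[of u v] by auto
  then have "0 \<le> c u v * (h (replace S u v) - h S) + c v u * (h (replace S v u) - h S)"
    using mixed[of u v] mixed[of v u] uv False by (cases "u \<in> S") (auto simp: add.commute)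
  then show ?thesis using nn by simp
qed

lemma edge_sum_pos:
  fixes c w :: "nat \<Rightarrow> nat \<Rightarrow> real"
  assumes sym: "\<And>u v. w u v = w v u" and nn: "\<And>u v. 0 \<le> w u v"
    and mixed: "\<And>u v. u < N \<Longrightarrow> v < N \<Longrightarrow> u \<in> S \<Longrightarrow> v \<notin> S \<Longrightarrow> 0 < w u v \<Longrightarrow>
       0 < c u v * (h (replace S u v) - h S) + c v u * (h (replace S v u) - h S)"
    and ex: "x < N" "y < N" "x \<in> S" "y \<notin> S" "0 < w x y"
  shows "0 < (\<Sum>u<N. \<Sum>v<N. c u v * w u v * (h (replace S u v) - h S))"
proof -
  define e where "e u v = c u v * (h (replace S u v) - h S) + c v u * (h (replace S v u) - h S)" for u v
  have nonneg: "0 \<le> w u v * e u v" if "u < N" "v < N" for u v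
    unfolding e_def using edge_sum_nonneg[OF sym nn, where c = c and h = h and S = S and N = N] mixed that
    by (meson less_imp_le)
  have "0 < w x y * e x y" using mixed[OF ex] ex by (simp add: e_def)
  then have "0 < (\<Sum>v<N. w x v * e x v)"
    using ex nonneg by (intro sum_pos2[of _ y]) auto
  then have "0 < (\<Sum>u<N. \<Sum>v<N. w u v * e u v)"
    using ex nonneg by - (rule sum_pos2[of _ x], auto intro!: sum_nonneg)
  then show ?thesis
    unfolding e_def using edge_sum_symmetrize[where w = w, OF sym, where c = c and N = N and d = "\<lambda>u v. h (replace S u v) - h S"] by linarith
qed

lemma edge_sum_nonpos:
  fixes c w :: "nat \<Rightarrow> nat \<Rightarrow> real"
  assumes sym: "\<And>u v. w u v = w v u" and nn: "\<And>u v. 0 \<le> w u v"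
    and mixed: "\<And>u v. u < N \<Longrightarrow> v < N \<Longrightarrow> u \<in> S \<Longrightarrow> v \<notin> S \<Longrightarrow> 0 < w u v \<Longrightarrow>
       c u v * (h (replace S u v) - h S) + c v u * (h (replace S v u) - h S) \<le> 0"
  shows "(\<Sum>u<N. \<Sum>v<N. c u v * w u v * (h (replace S u v) - h S)) \<le> 0"
proof -
  define e where "e u v = (-c u v) * (h (replace S u v) - h S) + (-c v u) * (h (replace S v u) - h S)" for u v
  have "0 \<le> w u v * e u v" if "u < N" "v < N" for u v
    unfolding e_def
  proof (rule edge_sum_nonneg[OF sym nn _ that])
    show "0 \<le> - c x y * (h (replace S x y) - h S) + - c y x * (h (replace S y x) - h S)"
      if "x < N" "y < N" "x \<in> S" "y \<notin> S" "0 < w x y" for x y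
      using mixed[OF that] by linarith
  qed
  then have "0 \<le> (\<Sum>u<N. \<Sum>v<N. w u v * e u v)" by (intro sum_nonneg) auto
  then have "0 \<le> (\<Sum>u<N. \<Sum>v<N. (-c u v) * w u v * (h (replace S u v) - h S))"
    unfolding e_def
    using edge_sum_symmetrize[where w = w, OF sym, where c = "\<lambda>u v. - c u v" and d = "\<lambda>u v. h (replace S u v) - h S" and N = N] by linarith
  then show ?thesis by (simp add: sum_negf)
qed

definition geo :: "real \<Rightarrow> nat \<Rightarrow> nat \<Rightarrow> real" where
  "geo t L i = (1 - t ^ i) / (1 - t ^ L)"

lemma geo_Suc_diff: "geo t L (Suc i) - geo t L i = t ^ i * ((1 - t) / (1 - t ^ L))"
  by (simp add: geo_def diff_divide_distrib[symmetric] algebra_simps)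

lemma geo_factor_pos: "0 < t \<Longrightarrow> t < 1 \<Longrightarrow> 0 < L \<Longrightarrow> 0 < (1 - t) / (1 - t ^ L)" for t :: real
  by (simp add: power_less_one_iff)

lemma geo_range:
  assumes "0 < t" "t < 1" "0 < L" "i \<le> L"
  shows "0 \<le> geo t L i" "geo t L i \<le> 1"
  using assms power_decreasing[of i L t] power_le_one[of t i] power_less_one_iff[of t L]
  by (auto simp: geo_def divide_simps)

lemma sum_complete_graph:
  "v < N \<Longrightarrow> (\<Sum>x<N. f x * complete_graph x v) = (\<Sum>x<N. f x) - f v"
proof -
  assume v: "v < N"
  have "(\<Sum>x<N. f x * complete_graph x v) = (\<Sum>x<N. f x - (if x = v then f x else 0))"
    by (intro sum.cong) (auto simp: complete_graph_def)
  then show ?thesis using v by (simp add: sum_subtractf)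
qed

lemma wgraph_complete_graph: "wgraph N complete_graph"
  by (auto simp: wgraph_def complete_graph_def)

lemma wdeg_complete_graph: "u < N \<Longrightarrow> wdeg N complete_graph u = real N - 1"
  using sum_complete_graph[of u N "\<lambda>_. 1"] by (simp add: wdeg_def complete_graph_def eq_commute)

lemma rho_complete_graph_le:
  assumes r: "1 < r" and N: "0 < N"
    and chain: "edge_chain N step (\<lambda>S u v. C S u v * complete_graph u v)"
    and C: "\<And>S u v. S \<subseteq> {..<N} \<Longrightarrow> u \<in> S \<Longrightarrow> v < N \<Longrightarrow> v \<notin> S \<Longrightarrow> C S u v \<le> r * C S v u"
  shows "rho step N \<le> (1 - 1 / r) / (1 - (1 / r) ^ N)"
proof -
  define s where "s = 1 / r"
  have s: "0 < s" "s < 1" using r by (auto simp: s_def)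
  have "fixation step N {v} \<le> geo s N (card {v})" if "v < N" for v
  proof (rule fixation_le_supermartingale[OF chain])
    show "0 \<le> geo s N (card S)" if "S \<subseteq> {..<N}" for S
      using that card_mono[of "{..<N}" S] s N by (intro geo_range) auto
    show "1 \<le> geo s N (card {..<N})"
      using s N power_less_one_iff[of s N] by (simp add: geo_def)
    show "step (\<lambda>S. geo s N (card S)) S \<le> geo s N (card S)" if S: "S \<subseteq> {..<N}" for S
    proof -
      have "(\<Sum>u<N. \<Sum>v<N. C S u v * complete_graph u v * (geo s N (card (replace S u v)) - geo s N (card S))) \<le> 0"
      proof (rule edge_sum_nonpos)
        fix u v assume uv: "u < N" "v < N" "u \<in> S" "v \<notin> S"
        have fin: "finite S" using S finite_subset by blast
        define i where "i = card (S - {u})"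
        have card: "card S = Suc i" "card (replace S u v) = Suc (Suc i)" "card (replace S v u) = i"
          using uv fin card_Suc_Diff1[OF fin uv(3)] by (auto simp: replace_def i_def)
        define K where "K = (1 - s) / (1 - s ^ N)"
        have diff: "geo s N (card (replace S u v)) - geo s N (card S) = s * s ^ i * K"
          "geo s N (card (replace S v u)) - geo s N (card S) = - (s ^ i * K)"
          using geo_Suc_diff[of s N i] geo_Suc_diff[of s N "Suc i"]
          unfolding card K_def[symmetric] by simp_all
        have "C S u v * s - C S v u \<le> 0"
          using C[OF S uv(3,2,4)] r by (simp add: s_def divide_simps mult.commute)
        then have "(C S u v * s - C S v u) * (s ^ i * K) \<le> 0"
          using less_imp_le[OF geo_factor_pos[OF s N]] s unfolding K_def
          by (intro mult_nonpos_nonneg mult_nonneg_nonneg) auto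
        then show "C S u v * (geo s N (card (replace S u v)) - geo s N (card S))
            + C S v u * (geo s N (card (replace S v u)) - geo s N (card S)) \<le> 0"
          unfolding diff by (simp add: algebra_simps)
      qed (auto simp: complete_graph_def)
      then show ?thesis using step_minus[OF chain S, of "\<lambda>S. geo s N (card S)"] by linarith
    qed
  qed (use that in auto)
  then have "(\<Sum>v<N. fixation step N {v}) \<le> (\<Sum>v<N. geo s N 1)" by (intro sum_mono) auto
  then show ?thesis using N by (simp add: rho_def geo_def s_def divide_simps mult.commute)
qed

lemma rho_Bd_complete_graph_le:
  assumes "1 < r" "2 \<le> N"
  shows "rho_Bd r N complete_graph \<le> (1 - 1 / r) / (1 - (1 / r) ^ N)"
  unfolding rho_Bd_def
  by (rule rho_complete_graph_le, use assms in simp, use assms in simp, rule edge_chain_Bd)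
    (use assms in \<open>auto simp: wgraph_complete_graph wdeg_complete_graph Bd_coeff_def fit_def\<close>)

lemma rho_dB_complete_graph_le:
  assumes r: "1 < r" and N: "2 \<le> N"
  shows "rho_dB r N complete_graph \<le> (1 - 1 / r) / (1 - (1 / r) ^ N)"
  unfolding rho_dB_def
proof (rule rho_complete_graph_le)
  show "edge_chain N (dB_step N complete_graph r) (\<lambda>S u v. dB_coeff N r complete_graph S u v * complete_graph u v)"
    using assms by (intro edge_chain_dB) (auto simp: wgraph_complete_graph wdeg_complete_graph)
  fix S u v assume S: "S \<subseteq> {..<N}" "u \<in> S" "v < N" "v \<notin> S"
  have u: "u < N" using S by auto
  define Z where "Z = (\<Sum>x<N. fit r S x)"
  have "0 < (\<Sum>x<N. fit r S x * complete_graph x u)"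
    using assms u by (intro fit_weight_sum_pos) (auto simp: wgraph_complete_graph wdeg_complete_graph)
  then have Z: "0 < Z - r" using S u by (simp add: sum_complete_graph Z_def fit_def)
  then have "r / (real N * (Z - 1)) \<le> r / (real N * (Z - r))"
    using r N by (intro divide_left_mono) auto
  then show "dB_coeff N r complete_graph S u v \<le> r * dB_coeff N r complete_graph S v u"
    using S u by (simp add: dB_coeff_def sum_complete_graph Z_def[symmetric]) (simp add: fit_def)
qed (use assms in auto)

locale hub_pairs =
  fixes q L :: nat and W :: real
  assumes q_pos: "0 < q" and L_ge: "4 \<le> L" and W_pos: "0 < W"
begin

abbreviation "N \<equiv> 4 * q + L"
abbreviation "hub \<equiv> {4 * q..<N}"

definition pair_weight :: "nat \<Rightarrow> real" where
  "pair_weight p = (if p < q then W else 1 / W)"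

definition core :: "nat \<Rightarrow> nat \<Rightarrow> real" where
  "core u v = (if u = v then 0 else if 4 * q \<le> u \<and> 4 * q \<le> v then 1
     else if u < 4 * q \<and> v < 4 * q \<and> u div 2 = v div 2 then pair_weight (u div 2) else 0)"

definition cross :: "nat \<Rightarrow> nat \<Rightarrow> real" where
  "cross u v = (if (u < 4 * q) \<noteq> (v < 4 * q) then 1 else 0)"

definition weight :: "real \<Rightarrow> nat \<Rightarrow> nat \<Rightarrow> real" where
  "weight \<epsilon> u v = core u v + \<epsilon> * cross u v"

definition partner :: "nat \<Rightarrow> nat" where
  "partner u = (if even u then u + 1 else u - 1)"

lemma partner_iff: "x div 2 = v div 2 \<and> x \<noteq> v \<longleftrightarrow> x = partner v"
  unfolding partner_def by (cases "even v") (auto elim!: evenE oddE)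

lemma partner_less: "v < 4 * q \<Longrightarrow> partner v < 4 * q"
  unfolding partner_def by (auto elim!: evenE)

lemma partner_div: "partner v div 2 = v div 2" "partner v \<noteq> v"
  using partner_iff[of "partner v" v] by auto

lemma pair_weight_pos: "0 < pair_weight p"
  using W_pos by (simp add: pair_weight_def)

lemma core_sym: "core u v = core v u" and core_nonneg: "0 \<le> core u v"
  using pair_weight_pos by (auto simp: core_def less_imp_le)

lemma cross_sym: "cross u v = cross v u" and cross_nonneg: "0 \<le> cross u v"
  by (auto simp: cross_def)

lemma sum_core:
  assumes "v < N"
  shows "(\<Sum>x<N. f x * core x v) =
    (if v < 4 * q then f (partner v) * pair_weight (v div 2) else (\<Sum>x\<in>hub. f x) - f v)"
proof (cases "v < 4 * q")
  case True
  have "core x v = (if x = partner v then pair_weight (v div 2) else 0)" for x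
    using True partner_iff[of x v] partner_less[OF True] by (auto simp: core_def)
  then have "(\<Sum>x<N. f x * core x v) = (\<Sum>x<N. if x = partner v then f x * pair_weight (v div 2) else 0)"
    by (intro sum.cong) auto
  then show ?thesis using True partner_less[OF True] by simp
next
  case False
  then have core: "core x v = (if 4 * q \<le> x \<and> x \<noteq> v then 1 else 0)" for x
    by (simp add: core_def)
  have "(\<Sum>x<N. f x * core x v) = (\<Sum>x\<in>hub - {v}. f x * core x v)"
    unfolding core by (rule sum.mono_neutral_right) auto
  also have "\<dots> = (\<Sum>x\<in>hub - {v}. f x)"
    unfolding core by (rule sum.cong) auto
  also have "\<dots> = (\<Sum>x\<in>hub. f x) - f v" using False assms by (subst sum_diff1) auto
  finally show ?thesis using False by simp
qed

lemma wdeg_core: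
  assumes "u < N"
  shows "wdeg N core u = (if u < 4 * q then pair_weight (u div 2) else real L - 1)"
  using sum_core[OF assms, of "\<lambda>_. 1"] by (simp add: wdeg_def core_sym)

lemma wdeg_core_pos: "u < N \<Longrightarrow> 0 < wdeg N core u"
  using L_ge by (simp add: wdeg_core pair_weight_pos)

lemma wgraph_weight: "0 \<le> \<epsilon> \<Longrightarrow> wgraph N (weight \<epsilon>)"
  unfolding wgraph_def weight_def
  using core_sym cross_sym core_nonneg cross_nonneg by (auto simp: core_def cross_def)

lemma wdeg_weight_pos:
  assumes "0 \<le> \<epsilon>" "u < N"
  shows "0 < wdeg N (weight \<epsilon>) u"
proof -
  have "wdeg N core u \<le> wdeg N (weight \<epsilon>) u"
    unfolding wdeg_def weight_def using assms cross_nonneg by (intro sum_mono) auto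
  then show ?thesis using wdeg_core_pos[OF assms(2)] by simp
qed

lemma connected_weight:
  assumes "0 < \<epsilon>"
  shows "connected_wgraph N (weight \<epsilon>)"
proof -
  define R where "R a b \<longleftrightarrow> a < N \<and> b < N \<and> 0 < weight \<epsilon> a b" for a b
  have sym: "R a b \<Longrightarrow> R b a" for a b
    using wgraph_weight[of \<epsilon>] assms by (auto simp: R_def wgraph_def)
  have pair: "R u (4 * q)" if "u < 4 * q" for u
    using that assms core_nonneg[of u "4 * q"] L_ge by (auto simp: R_def weight_def cross_def intro: add_nonneg_pos)
  have hub: "R u (4 * q)" if "4 * q < u" "u < N" for u
    using that by (auto simp: R_def weight_def cross_def core_def)
  have to: "R\<^sup>*\<^sup>* u (4 * q)" and fro: "R\<^sup>*\<^sup>* (4 * q) u" if "u < N" for u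
    using pair[of u] hub[of u] that sym by (cases "u = 4 * q"; fastforce)+
  have "R\<^sup>*\<^sup>* u v" if "u < N" "v < N" for u v
    using to[OF that(1)] fro[OF that(2)] by (rule rtranclp_trans)
  then show ?thesis
    unfolding connected_wgraph_def R_def[abs_def] using wgraph_weight assms by auto
qed

text \<open>The value of a mixed pair is slightly below its fixation probability (1/2 under dB,
  \<open>r / (r + 1)\<close> under Bd), which makes the drift strict.\<close>

definition pair_state :: "nat set \<Rightarrow> nat \<Rightarrow> real" where
  "pair_state S p = (if 2 * p \<in> S then (if 2 * p + 1 \<in> S then 1 else 49 / 100)
     else if 2 * p + 1 \<in> S then 49 / 100 else 0)"

text \<open>\<open>low\<close> and \<open>high\<close> are the values of the potential for a resident and for a mutant hub. The factor
  \<open>lam p\<close> is close to 1 on the pairs that dominate the hub and tiny, but positive, on the others.\<close>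

definition low :: "(nat \<Rightarrow> real) \<Rightarrow> (nat \<Rightarrow> real) \<Rightarrow> real" where
  "low lam x = 17 / 20 * (1 - (\<Prod>p<2*q. 1 - lam p * x p))"

definition high :: "(nat \<Rightarrow> real) \<Rightarrow> real" where
  "high x = 1 - (\<Sum>p<2*q. 1 - x p) / (40 * real q)"

definition pot :: "(nat \<Rightarrow> real) \<Rightarrow> real \<Rightarrow> (nat \<Rightarrow> real) \<Rightarrow> nat \<Rightarrow> real" where
  "pot lam t x k = low lam x + geo t L k * (high x - low lam x)"

definition potential :: "(nat \<Rightarrow> real) \<Rightarrow> real \<Rightarrow> nat set \<Rightarrow> real" where
  "potential lam t S = pot lam t (pair_state S) (card (S \<inter> hub))"

text \<open>The partial derivative of \<open>pot\<close> with respect to the state of pair \<open>p\<close>.\<close>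

definition slope :: "(nat \<Rightarrow> real) \<Rightarrow> real \<Rightarrow> (nat \<Rightarrow> real) \<Rightarrow> nat \<Rightarrow> nat \<Rightarrow> real" where
  "slope lam t x k p =
     (1 - geo t L k) * (17 / 20 * lam p * (\<Prod>p'\<in>{..<2*q} - {p}. 1 - lam p' * x p')) + geo t L k / (40 * real q)"

lemma low_update:
  assumes "p < 2 * q"
  shows "low lam (x(p := y)) - low lam x
    = (y - x p) * (17 / 20 * lam p * (\<Prod>p'\<in>{..<2*q} - {p}. 1 - lam p' * x p'))"
proof -
  have "(\<Prod>p'<2*q. 1 - lam p' * z p') = (1 - lam p * z p) * (\<Prod>p'\<in>{..<2*q} - {p}. 1 - lam p' * z p')" for z
    using assms by (intro prod.remove) auto
  moreover have "(\<Prod>p'\<in>{..<2*q} - {p}. 1 - lam p' * (x(p := y)) p') = (\<Prod>p'\<in>{..<2*q} - {p}. 1 - lam p' * x p')"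
    by (intro prod.cong) auto
  ultimately show ?thesis unfolding low_def by (simp only: fun_upd_same) (simp add: algebra_simps)
qed

lemma high_update:
  assumes "p < 2 * q"
  shows "high (x(p := y)) - high x = (y - x p) / (40 * real q)"
proof -
  have "(\<Sum>p'<2*q. 1 - z p') = (1 - z p) + (\<Sum>p'\<in>{..<2*q} - {p}. 1 - z p')" for z :: "nat \<Rightarrow> real"
    using assms by (intro sum.remove) auto
  moreover have "(\<Sum>p'\<in>{..<2*q} - {p}. 1 - (x(p := y)) p') = (\<Sum>p'\<in>{..<2*q} - {p}. 1 - x p')"
    by (intro sum.cong) auto
  ultimately show ?thesis unfolding high_def by (simp add: divide_simps)
qed

lemma pot_update:
  assumes "p < 2 * q"
  shows "pot lam t (x(p := y)) k - pot lam t x k = (y - x p) * slope lam t x k p"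
proof -
  have "pot lam t (x(p := y)) k - pot lam t x k
      = (1 - geo t L k) * (low lam (x(p := y)) - low lam x) + geo t L k * (high (x(p := y)) - high x)"
    by (simp add: pot_def algebra_simps)
  then show ?thesis
    by (simp add: low_update[OF assms] high_update[OF assms] slope_def distrib_left mult_ac)
qed

lemma pot_Suc: "pot lam t x (Suc k) - pot lam t x k
    = t ^ k * ((1 - t) / (1 - t ^ L)) * (high x - low lam x)"
  using geo_Suc_diff[of t L k] by (simp add: pot_def flip: left_diff_distrib)

lemma pair_state_range: "0 \<le> pair_state S p" "pair_state S p \<le> 1"
  by (auto simp: pair_state_def)

lemma pair_state_toggle:
  "p \<noteq> v div 2 \<Longrightarrow> pair_state (insert v S) p = pair_state S p"
  "p \<noteq> v div 2 \<Longrightarrow> pair_state (S - {v}) p = pair_state S p"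
  by (auto simp: pair_state_def)

lemma low_high_cong:
  assumes "\<And>p. p < 2 * q \<Longrightarrow> x p = y p"
  shows "low lam x = low lam y" "high x = high y"
  using assms by (simp_all add: low_def high_def)

lemma hub_toggle:
  assumes "4 * q \<le> v"
  shows "low lam (pair_state (insert v S)) = low lam (pair_state S)"
    "high (pair_state (insert v S)) = high (pair_state S)"
    "low lam (pair_state (S - {v})) = low lam (pair_state S)"
    "high (pair_state (S - {v})) = high (pair_state S)"
  using assms by (intro low_high_cong pair_state_toggle; linarith)+

lemma potential_insert_hub:
  assumes "v \<in> hub" "v \<notin> S"
  shows "potential lam t (insert v S) - potential lam t S
    = t ^ card (S \<inter> hub) * ((1 - t) / (1 - t ^ L)) * (high (pair_state S) - low lam (pair_state S))"
proof -
  have "insert v S \<inter> hub = insert v (S \<inter> hub)" using assms by auto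
  then have "card (insert v S \<inter> hub) = Suc (card (S \<inter> hub))" using assms by simp
  then show ?thesis
    using pot_Suc[of lam t "pair_state S" "card (S \<inter> hub)"] assms(1)
    by (simp add: potential_def pot_def hub_toggle)
qed

lemma potential_remove_hub:
  assumes "u \<in> hub" "u \<in> S" "card (S \<inter> hub) = Suc k"
  shows "potential lam t (S - {u}) - potential lam t S
    = - (t ^ k * ((1 - t) / (1 - t ^ L)) * (high (pair_state S) - low lam (pair_state S)))"
proof -
  have "(S - {u}) \<inter> hub = S \<inter> hub - {u}" by auto
  then have "card ((S - {u}) \<inter> hub) = k" "insert u (S - {u}) = S"
    using assms by auto
  then show ?thesis
    using potential_insert_hub[of u "S - {u}" lam t] assms(1) by (simp add: hub_toggle)
qed

lemma potential_toggle_pair: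
  assumes "v < 4 * q"
  shows "potential lam t (insert v S) - potential lam t S
      = (pair_state (insert v S) (v div 2) - pair_state S (v div 2)) * slope lam t (pair_state S) (card (S \<inter> hub)) (v div 2)"
    "potential lam t (S - {v}) - potential lam t S
      = (pair_state (S - {v}) (v div 2) - pair_state S (v div 2)) * slope lam t (pair_state S) (card (S \<inter> hub)) (v div 2)"
proof -
  have p: "v div 2 < 2 * q" using assms by linarith
  have *: "potential lam t T - potential lam t S
      = (pair_state T (v div 2) - pair_state S (v div 2)) * slope lam t (pair_state S) (card (S \<inter> hub)) (v div 2)"
    if "T \<inter> hub = S \<inter> hub" "\<And>p. p \<noteq> v div 2 \<Longrightarrow> pair_state T p = pair_state S p" for T
  proof -
    have "pair_state T = (pair_state S)(v div 2 := pair_state T (v div 2))"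
      using that(2) by (intro ext) auto
    then show ?thesis
      unfolding potential_def that(1) by (metis pot_update[OF p])
  qed
  show "potential lam t (insert v S) - potential lam t S
      = (pair_state (insert v S) (v div 2) - pair_state S (v div 2)) * slope lam t (pair_state S) (card (S \<inter> hub)) (v div 2)"
    by (rule *) (use assms in \<open>auto simp: pair_state_toggle\<close>)
  show "potential lam t (S - {v}) - potential lam t S
      = (pair_state (S - {v}) (v div 2) - pair_state S (v div 2)) * slope lam t (pair_state S) (card (S \<inter> hub)) (v div 2)"
    by (rule *) (use assms in \<open>auto simp: pair_state_toggle\<close>)
qed

lemma pair_state_partner:
  "pair_state S (v div 2) = (if v \<in> S then (if partner v \<in> S then 1 else 49 / 100)
     else if partner v \<in> S then 49 / 100 else 0)"
  by (cases "even v") (auto elim!: evenE oddE simp: pair_state_def partner_def)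

lemma high_range:
  assumes "\<And>p. 0 \<le> x p" "\<And>p. x p \<le> 1"
  shows "19 / 20 \<le> high x" "high x \<le> 1"
proof -
  have "(\<Sum>p<2*q. 1 - x p) \<le> (\<Sum>p<2*q. 1)" using assms by (intro sum_mono) auto
  then show "19 / 20 \<le> high x" using q_pos by (simp add: high_def divide_simps)
  have "0 \<le> (\<Sum>p<2*q. 1 - x p)" using assms by (intro sum_nonneg) auto
  then show "high x \<le> 1" using q_pos by (simp add: high_def)
qed

lemma card_Int_hub_le: "card (S \<inter> hub) \<le> L"
  using card_mono[of hub "S \<inter> hub"] by simp

end

locale hub_potential = hub_pairs +
  fixes lam :: "nat \<Rightarrow> real" and t :: real
  assumes lam_pos: "0 < lam p" and lam_le: "lam p \<le> 19 / 20" and t_pos: "0 < t" and t_less: "t < 1"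
begin

abbreviation "\<Phi> \<equiv> potential lam t"

lemma factor_pos: "0 < 1 - lam p * pair_state S p"
proof -
  have "lam p * pair_state S p \<le> 19 / 20 * 1"
    using lam_pos[of p] lam_le[of p] pair_state_range by (intro mult_mono) (auto simp: less_imp_le)
  then show ?thesis by simp
qed

lemma factor_le: "1 - lam p * pair_state S p \<le> 1"
  using lam_pos[of p] pair_state_range(1)[of S p] by simp

lemma low_range: "0 \<le> low lam (pair_state S)" "low lam (pair_state S) \<le> 17 / 20"
proof -
  have "(\<Prod>p<2*q. 1 - lam p * pair_state S p) \<le> 1"
    using factor_pos factor_le by (intro prod_le_1) (auto simp: less_imp_le)
  then show "0 \<le> low lam (pair_state S)" by (simp add: low_def)
  have "0 \<le> (\<Prod>p<2*q. 1 - lam p * pair_state S p)"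
    using factor_pos by (intro prod_nonneg) (auto simp: less_imp_le)
  then show "low lam (pair_state S) \<le> 17 / 20" by (simp add: low_def)
qed

lemma gap_range:
  "1 / 10 \<le> high (pair_state S) - low lam (pair_state S)"
  "high (pair_state S) - low lam (pair_state S) \<le> 1"
  using low_range[of S] high_range[of "pair_state S"] pair_state_range by force+

lemma geo_unit: "(1 - t) \<le> (1 - t) / (1 - t ^ L)" "(1 - t) / (1 - t ^ L) \<le> 1"
  and geo_unit_pos: "0 < (1 - t) / (1 - t ^ L)"
proof -
  have "t ^ L \<le> t ^ 1" using L_ge t_pos t_less by (intro power_decreasing) auto
  moreover have "0 < t ^ L" using t_pos by simp
  ultimately show "(1 - t) \<le> (1 - t) / (1 - t ^ L)" "(1 - t) / (1 - t ^ L) \<le> 1" "0 < (1 - t) / (1 - t ^ L)"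
    using t_less by (auto simp: divide_simps mult_le_cancel_left1)
qed

lemma rest_prod:
  "0 < (\<Prod>p'\<in>A. 1 - lam p' * pair_state S p')" "(\<Prod>p'\<in>A. 1 - lam p' * pair_state S p') \<le> 1"
  using factor_pos factor_le by (auto intro!: prod_pos prod_le_1 simp: less_imp_le)

lemma slope_pos: "k \<le> L \<Longrightarrow> 0 < slope lam t (pair_state S) k p"
proof -
  assume k: "k \<le> L"
  define R where "R = 17 / 20 * lam p * (\<Prod>p'\<in>{..<2*q} - {p}. 1 - lam p' * pair_state S p')"
  have R: "0 < R" unfolding R_def using rest_prod(1) lam_pos by simp
  have g: "0 \<le> geo t L k" "geo t L k \<le> 1" using k geo_range[OF t_pos t_less] L_ge by auto
  show ?thesis
  proof (cases "geo t L k = 1")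
    case True
    then show ?thesis using q_pos by (simp add: slope_def)
  next
    case False
    then have "0 < (1 - geo t L k) * R" using g R by simp
    then show ?thesis unfolding slope_def R_def[symmetric] using g by (simp add: add_pos_nonneg)
  qed
qed

lemma slope_0_le: "slope lam t (pair_state S) 0 p \<le> lam p"
proof -
  have "lam p * (\<Prod>p'\<in>{..<2*q} - {p}. 1 - lam p' * pair_state S p') \<le> lam p * 1"
    using rest_prod lam_pos[of p] by (intro mult_left_mono) auto
  then show ?thesis using lam_pos[of p] by (simp add: slope_def geo_def)
qed

lemma slope_L: "slope lam t x L p = 1 / (40 * real q)"
  using t_pos t_less L_ge power_less_one_iff[of t L] by (simp add: slope_def geo_def)

definition gain :: "(nat \<Rightarrow> nat \<Rightarrow> real) \<Rightarrow> nat set \<Rightarrow> nat \<Rightarrow> nat \<Rightarrow> real" where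
  "gain c S u v = c u v * (\<Phi> (replace S u v) - \<Phi> S) + c v u * (\<Phi> (replace S v u) - \<Phi> S)"

lemma gain_hub_edge:
  assumes "u \<in> hub" "u \<in> S" "v \<in> hub" "v \<notin> S" and c: "c v u < t * c u v"
  shows "0 < gain c S u v"
proof -
  have "card (S \<inter> hub) \<noteq> 0" using assms by auto
  then obtain k where k: "card (S \<inter> hub) = Suc k" by (cases "card (S \<inter> hub)") auto
  define K where "K = (1 - t) / (1 - t ^ L) * (high (pair_state S) - low lam (pair_state S))"
  have "0 < K" unfolding K_def using geo_unit_pos gap_range(1)[of S] by (intro mult_pos_pos) auto
  then have "0 < (t * c u v - c v u) * (t ^ k * K)" using c t_pos by simp
  also have "\<dots> = gain c S u v"
  proof -
    have d: "\<Phi> (replace S u v) - \<Phi> S = t * t ^ k * K" "\<Phi> (replace S v u) - \<Phi> S = - (t ^ k * K)"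
      using potential_insert_hub[OF assms(3,4), of lam t] potential_remove_hub[OF assms(1,2) k, of lam t] assms(2,4)
      by (simp_all add: replace_def k K_def)
    show ?thesis unfolding gain_def d by (simp add: algebra_simps)
  qed
  finally show ?thesis .
qed

lemma gain_pair_edge:
  assumes "u < 4 * q" "u \<in> S" "v = partner u" "v \<notin> S" and c: "c v u \<le> c u v" "0 < c v u"
  shows "0 < gain c S u v"
proof -
  have v: "v < 4 * q" "v div 2 = u div 2" "partner v = u" "u \<noteq> v"
    using assms(1,3) partner_less partner_div partner_iff[of u v] by auto
  define D where "D = slope lam t (pair_state S) (card (S \<inter> hub)) (u div 2)"
  have "0 < D" unfolding D_def by (rule slope_pos[OF card_Int_hub_le])
  then have "0 < (51 / 100 * c u v - 49 / 100 * c v u) * D" using c by simp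
  also have "\<dots> = gain c S u v"
  proof -
    have "pair_state (insert v S) (u div 2) = 1" "pair_state (S - {u}) (u div 2) = 0" "pair_state S (u div 2) = 49 / 100"
      using assms(2-4) by (auto simp: pair_state_partner)
    then have d: "\<Phi> (replace S u v) - \<Phi> S = 51 / 100 * D" "\<Phi> (replace S v u) - \<Phi> S = - (49 / 100 * D)"
      using potential_toggle_pair(1)[OF v(1), of lam t S] potential_toggle_pair(2)[OF assms(1), of lam t S] assms(2,4)
      by (simp_all add: replace_def D_def v(2))
    show ?thesis unfolding gain_def d by (simp add: algebra_simps)
  qed
  finally show ?thesis .
qed

lemma gain_cross_resident_hub:
  assumes "S \<inter> hub = {}" "u < 4 * q" "u \<in> S" "partner u \<in> S" "v \<in> hub"
    and c: "0 \<le> c v u" "c v u * lam (u div 2) < c u v * ((1 - t) / 10)"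
  shows "0 < gain c S u v"
proof -
  have v: "v \<notin> S" using assms by auto
  have "0 \<le> c v u * lam (u div 2)" using c lam_pos[of "u div 2"] by simp
  then have "0 < c u v * ((1 - t) / 10)" using c by linarith
  then have cuv: "0 < c u v" using t_less by (simp add: zero_less_mult_iff)
  have "(1 - t) * (1 / 10) \<le> (1 - t) / (1 - t ^ L) * (high (pair_state S) - low lam (pair_state S))"
    using geo_unit gap_range t_less by (intro mult_mono) auto
  then have up: "c u v * ((1 - t) / 10) \<le> c u v * (\<Phi> (insert v S) - \<Phi> S)"
    using potential_insert_hub[OF assms(5) v, of lam t] assms(1) cuv by (intro mult_left_mono) auto
  have "\<Phi> (S - {u}) - \<Phi> S = - (51 / 100 * slope lam t (pair_state S) 0 (u div 2))"
    using potential_toggle_pair(2)[OF assms(2), of lam t S] assms partner_div[of u]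
    by (simp add: pair_state_partner)
  then have "- lam (u div 2) \<le> \<Phi> (S - {u}) - \<Phi> S"
    using slope_0_le[of S "u div 2"] slope_pos[of 0 S "u div 2"] by linarith
  then have "c v u * (- lam (u div 2)) \<le> c v u * (\<Phi> (S - {u}) - \<Phi> S)"
    using c by (intro mult_left_mono) auto
  then show ?thesis using up c v assms(3) by (simp add: gain_def replace_def)
qed

lemma gain_cross_mutant_hub:
  assumes "hub \<subseteq> S" "v < 4 * q" "v \<notin> S" "partner v \<notin> S" "u \<in> hub"
    and c: "0 \<le> c v u" "c v u * t ^ (L - 1) < c u v * (49 / (4000 * real q))"
  shows "0 < gain c S u v"
proof -
  have card: "card (S \<inter> hub) = L" using assms(1) by (simp add: Int_absorb1)
  have up: "\<Phi> (insert v S) - \<Phi> S = 49 / (4000 * real q)"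
    using potential_toggle_pair(1)[OF assms(2), of lam t S] assms partner_div[of v]
    by (simp add: pair_state_partner card slope_L)
  have u: "u \<in> S" using assms by auto
  have "t ^ (L - 1) * ((1 - t) / (1 - t ^ L) * (high (pair_state S) - low lam (pair_state S))) \<le> t ^ (L - 1) * (1 * 1)"
    using geo_unit geo_unit_pos gap_range[of S] t_pos by (intro mult_left_mono mult_mono) auto
  then have "- (t ^ (L - 1)) \<le> \<Phi> (S - {u}) - \<Phi> S"
    using potential_remove_hub[OF assms(5) u, of "L - 1" lam t] card L_ge by simp
  then have "c v u * (- (t ^ (L - 1))) \<le> c v u * (\<Phi> (S - {u}) - \<Phi> S)"
    using c by (intro mult_left_mono) auto
  then show ?thesis using up c u assms(3) by (simp add: gain_def replace_def)
qed

lemma eventually_drift_pos: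
  assumes S: "S \<subseteq> {..<N}" "S \<noteq> {}" "S \<noteq> {..<N}"
    and lim: "\<And>u v. u < N \<Longrightarrow> v < N \<Longrightarrow> ((\<lambda>\<epsilon>. C \<epsilon> u v) \<longlongrightarrow> c u v) (at_right 0)"
    and pos: "\<And>u v. u < N \<Longrightarrow> v < N \<Longrightarrow> 0 < c u v"
    and hub: "\<And>u v. u \<in> hub \<Longrightarrow> v \<in> hub \<Longrightarrow> u \<in> S \<Longrightarrow> v \<notin> S \<Longrightarrow> c v u < t * c u v"
    and pair: "\<And>u. u < 4 * q \<Longrightarrow> u \<in> S \<Longrightarrow> partner u \<notin> S \<Longrightarrow> c (partner u) u \<le> c u (partner u)"
    and resident: "\<And>u v. S \<inter> hub = {} \<Longrightarrow> u < 4 * q \<Longrightarrow> u \<in> S \<Longrightarrow> partner u \<in> S \<Longrightarrow> v \<in> hub \<Longrightarrow>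
      c v u * lam (u div 2) < c u v * ((1 - t) / 10)"
    and mutant: "\<And>u v. hub \<subseteq> S \<Longrightarrow> v < 4 * q \<Longrightarrow> v \<notin> S \<Longrightarrow> partner v \<notin> S \<Longrightarrow> u \<in> hub \<Longrightarrow>
      c v u * t ^ (L - 1) < c u v * (49 / (4000 * real q))"
  shows "\<forall>\<^sub>F \<epsilon> in at_right 0. 0 < (\<Sum>u<N. \<Sum>v<N. C \<epsilon> u v * weight \<epsilon> u v * (\<Phi> (replace S u v) - \<Phi> S))"
proof (cases "\<exists>x<N. \<exists>y<N. x \<in> S \<and> y \<notin> S \<and> 0 < core x y")
  case True
  then obtain x y where xy: "x < N" "y < N" "x \<in> S" "y \<notin> S" "0 < core x y" by blast
  have "0 < (\<Sum>u<N. \<Sum>v<N. c u v * core u v * (\<Phi> (replace S u v) - \<Phi> S))"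
  proof (rule edge_sum_pos[OF core_sym core_nonneg _ xy])
    fix u v assume uv: "u < N" "v < N" "u \<in> S" "v \<notin> S" "0 < core u v"
    have "u \<in> hub \<and> v \<in> hub \<or> u < 4 * q \<and> v = partner u"
      using uv partner_iff[of v u] by (auto simp: core_def split: if_splits)
    then have "0 < gain c S u v"
    proof
      assume "u \<in> hub \<and> v \<in> hub"
      then show ?thesis using uv hub[of u v] by (intro gain_hub_edge) auto
    next
      assume "u < 4 * q \<and> v = partner u"
      then show ?thesis using uv pair[of u] pos[of v u] by (intro gain_pair_edge) auto
    qed
    then show "0 < c u v * (\<Phi> (replace S u v) - \<Phi> S) + c v u * (\<Phi> (replace S v u) - \<Phi> S)"
      by (simp add: gain_def)
  qed
  moreover have "((\<lambda>\<epsilon>. \<Sum>u<N. \<Sum>v<N. C \<epsilon> u v * weight \<epsilon> u v * (\<Phi> (replace S u v) - \<Phi> S))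
    \<longlongrightarrow> (\<Sum>u<N. \<Sum>v<N. c u v * (core u v + 0 * cross u v) * (\<Phi> (replace S u v) - \<Phi> S))) (at_right 0)"
    unfolding weight_def by (intro tendsto_intros lim) auto
  ultimately show ?thesis by (auto dest: order_tendstoD(1))
next
  case False
  have core0: "core u v * (\<Phi> (replace S u v) - \<Phi> S) = 0" if "u < N" "v < N" for u v
  proof (cases "u \<in> S \<longleftrightarrow> v \<in> S")
    case True
    then show ?thesis by (simp add: replace_same)
  next
    case mixed: False
    then have "\<not> 0 < core u v"
      using False that core_sym[of u v] by (cases "u \<in> S") (auto, metis)
    then show ?thesis using core_nonneg[of u v] by simp
  qed
  have pairs: "u \<in> S \<longleftrightarrow> partner u \<in> S" if "u < 4 * q" for u
  proof -
    have "0 < core u (partner u)" "0 < core (partner u) u"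
      using that partner_less[OF that] partner_div[of u] pair_weight_pos by (auto simp: core_def)
    moreover have "u < N" "partner u < N" using that partner_less[OF that] by auto
    ultimately show ?thesis using False by blast
  qed
  have hubs: "hub \<subseteq> S \<or> S \<inter> hub = {}"
  proof (rule ccontr)
    assume "\<not> ?thesis"
    then obtain x y where "x \<in> hub" "x \<in> S" "y \<in> hub" "y \<notin> S" by blast
    then have "x < N" "y < N" "x \<in> S" "y \<notin> S" "0 < core x y" by (auto simp: core_def)
    then show False using False by blast
  qed
  have "4 * q \<in> hub" using L_ge by simp
  have ex: "\<exists>x<N. \<exists>y<N. x \<in> S \<and> y \<notin> S \<and> 0 < cross x y"
    using hubs
  proof
    assume h: "hub \<subseteq> S"
    obtain y where "y < N" "y \<notin> S" using S by auto
    moreover from this have "y \<notin> hub" using h by blast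
    ultimately have "4 * q < N" "4 * q \<in> S" "y < N" "y \<notin> S" "0 < cross (4 * q) y"
      using h \<open>4 * q \<in> hub\<close> by (auto simp: cross_def)
    then show ?thesis by blast
  next
    assume h: "S \<inter> hub = {}"
    obtain x where "x \<in> S" "x < N" using S by auto
    moreover from this have "x \<notin> hub" using h by blast
    ultimately have "x < N" "x \<in> S" "4 * q < N" "4 * q \<notin> S" "0 < cross x (4 * q)"
      using h \<open>4 * q \<in> hub\<close> by (auto simp: cross_def)
    then show ?thesis by blast
  qed
  then obtain x y where xy: "x < N" "y < N" "x \<in> S" "y \<notin> S" "0 < cross x y" by blast
  have "0 < (\<Sum>u<N. \<Sum>v<N. c u v * cross u v * (\<Phi> (replace S u v) - \<Phi> S))"
  proof (rule edge_sum_pos[OF cross_sym cross_nonneg _ xy])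
    fix u v assume uv: "u < N" "v < N" "u \<in> S" "v \<notin> S" "0 < cross u v"
    then consider "u < 4 * q" "v \<in> hub" | "u \<in> hub" "v < 4 * q"
      by (cases "u < 4 * q"; cases "v < 4 * q") (auto simp: cross_def)
    then have "0 < gain c S u v"
    proof cases
      case 1
      then have "S \<inter> hub = {}" using hubs uv by auto
      then show ?thesis using 1 uv pairs[of u] resident[of u v] pos[of v u]
        by (intro gain_cross_resident_hub) auto
    next
      case 2
      then have "hub \<subseteq> S" using hubs uv by auto
      then show ?thesis using 2 uv pairs[of v] mutant[of v u] pos[of v u]
        by (intro gain_cross_mutant_hub) auto
    qed
    then show "0 < c u v * (\<Phi> (replace S u v) - \<Phi> S) + c v u * (\<Phi> (replace S v u) - \<Phi> S)"
      by (simp add: gain_def)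
  qed
  moreover have "((\<lambda>\<epsilon>. \<Sum>u<N. \<Sum>v<N. C \<epsilon> u v * cross u v * (\<Phi> (replace S u v) - \<Phi> S))
    \<longlongrightarrow> (\<Sum>u<N. \<Sum>v<N. c u v * cross u v * (\<Phi> (replace S u v) - \<Phi> S))) (at_right 0)"
    by (intro tendsto_intros lim) auto
  ultimately have "\<forall>\<^sub>F \<epsilon> in at_right 0. 0 < (\<Sum>u<N. \<Sum>v<N. C \<epsilon> u v * cross u v * (\<Phi> (replace S u v) - \<Phi> S))"
    by (auto dest: order_tendstoD(1))
  then show ?thesis
    using eventually_at_right_less[of 0]
  proof eventually_elim
    case (elim \<epsilon>)
    have "(\<Sum>u<N. \<Sum>v<N. C \<epsilon> u v * weight \<epsilon> u v * (\<Phi> (replace S u v) - \<Phi> S))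
        = (\<Sum>u<N. \<Sum>v<N. \<epsilon> * (C \<epsilon> u v * cross u v * (\<Phi> (replace S u v) - \<Phi> S)))"
    proof (intro sum.cong refl)
      fix u v assume "u \<in> {..<N}" "v \<in> {..<N}"
      then have "C \<epsilon> u v * (core u v * (\<Phi> (replace S u v) - \<Phi> S)) = 0" using core0 by simp
      then show "C \<epsilon> u v * weight \<epsilon> u v * (\<Phi> (replace S u v) - \<Phi> S)
          = \<epsilon> * (C \<epsilon> u v * cross u v * (\<Phi> (replace S u v) - \<Phi> S))"
        unfolding weight_def by (simp add: algebra_simps)
    qed
    then show ?case using elim by (simp flip: sum_distrib_left)
  qed
qed

lemma eventually_fixation_ge:
  assumes chain: "\<And>\<epsilon>. 0 < \<epsilon> \<Longrightarrow> edge_chain N (step \<epsilon>) (\<lambda>S u v. C \<epsilon> S u v * weight \<epsilon> u v)"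
    and lim: "\<And>S u v. u < N \<Longrightarrow> v < N \<Longrightarrow> ((\<lambda>\<epsilon>. C \<epsilon> S u v) \<longlongrightarrow> c S u v) (at_right 0)"
    and pos: "\<And>S u v. u < N \<Longrightarrow> v < N \<Longrightarrow> 0 < c S u v"
    and hub: "\<And>S u v. u \<in> hub \<Longrightarrow> v \<in> hub \<Longrightarrow> u \<in> S \<Longrightarrow> v \<notin> S \<Longrightarrow> c S v u < t * c S u v"
    and pair: "\<And>S u. u < 4 * q \<Longrightarrow> u \<in> S \<Longrightarrow> partner u \<notin> S \<Longrightarrow> c S (partner u) u \<le> c S u (partner u)"
    and resident: "\<And>S u v. S \<inter> hub = {} \<Longrightarrow> u < 4 * q \<Longrightarrow> u \<in> S \<Longrightarrow> partner u \<in> S \<Longrightarrow> v \<in> hub \<Longrightarrow>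
      c S v u * lam (u div 2) < c S u v * ((1 - t) / 10)"
    and mutant: "\<And>S u v. hub \<subseteq> S \<Longrightarrow> v < 4 * q \<Longrightarrow> v \<notin> S \<Longrightarrow> partner v \<notin> S \<Longrightarrow> u \<in> hub \<Longrightarrow>
      c S v u * t ^ (L - 1) < c S u v * (49 / (4000 * real q))"
  shows "\<forall>\<^sub>F \<epsilon> in at_right 0. \<forall>S\<subseteq>{..<N}. \<Phi> S \<le> fixation (step \<epsilon>) N S"
proof -
  define V where "V = {S. S \<subseteq> {..<N} \<and> S \<noteq> {} \<and> S \<noteq> {..<N}}"
  have "finite V" unfolding V_def by (rule finite_subset[of _ "Pow {..<N}"]) auto
  moreover have "\<forall>S\<in>V. \<forall>\<^sub>F \<epsilon> in at_right 0.
      0 < (\<Sum>u<N. \<Sum>v<N. C \<epsilon> S u v * weight \<epsilon> u v * (\<Phi> (replace S u v) - \<Phi> S))"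
    using assms by (intro ballI eventually_drift_pos[where c = "c S" for S]) (auto simp: V_def)
  ultimately have "\<forall>\<^sub>F \<epsilon> in at_right 0. \<forall>S\<in>V.
      0 < (\<Sum>u<N. \<Sum>v<N. C \<epsilon> S u v * weight \<epsilon> u v * (\<Phi> (replace S u v) - \<Phi> S))"
    by (rule eventually_ball_finite)
  then show ?thesis
    using eventually_at_right_less[of 0]
  proof eventually_elim
    case (elim \<epsilon>)
    note ch = chain[OF elim(2)]
    have empty: "\<Phi> {} \<le> 0"
      by (simp add: potential_def pot_def geo_def low_def pair_state_def)
    have "{..<N} \<inter> hub = hub" by auto
    then have "\<Phi> {..<N} = low lam (pair_state {..<N}) + 1 * (high (pair_state {..<N}) - low lam (pair_state {..<N}))"
      using t_pos t_less L_ge power_less_one_iff[of t L]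
      by (simp add: potential_def pot_def geo_def)
    then have full: "\<Phi> {..<N} \<le> 1"
      using high_range(2)[of "pair_state {..<N}"] pair_state_range by simp
    have "\<Phi> S < step \<epsilon> \<Phi> S" if "S \<subseteq> {..<N}" "S \<noteq> {}" "S \<noteq> {..<N}" for S
      using step_minus[OF ch that(1), of \<Phi>] elim(1) that by (auto simp: V_def)
    then show ?case
      by (intro allI impI fixation_ge_strict_submartingale[OF ch empty full])
  qed
qed

lemma potential_single_pair:
  assumes "v < 4 * q"
  shows "\<Phi> {v} = 833 / 2000 * lam (v div 2)"
proof -
  have "v div 2 < 2 * q" using assms by linarith
  moreover have "{v} \<inter> hub = {}" using assms by auto
  moreover have "low lam (\<lambda>p. 0) = 0" by (simp add: low_def)
  moreover have "pair_state {v} = (\<lambda>p. 0)(v div 2 := 49 / 100)"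
  proof
    fix p
    show "pair_state {v} p = ((\<lambda>p. 0)(v div 2 := 49 / 100)) p"
      using pair_state_toggle(1)[of p v "{}"] pair_state_partner[of "{v}" v] partner_div[of v]
      by (auto simp: pair_state_def[of "{}"])
  qed
  ultimately show ?thesis
    using low_update[of "v div 2" lam "\<lambda>p. 0" "49 / 100"] by (simp add: potential_def pot_def geo_def)
qed

end

context hub_pairs
begin

lemma coeff_limits:
  assumes "1 < r" "u < N" "v < N"
  shows "((\<lambda>\<epsilon>. Bd_coeff N r (weight \<epsilon>) S u v) \<longlongrightarrow> Bd_coeff N r core S u v) (at_right 0)"
    and "((\<lambda>\<epsilon>. dB_coeff N r (weight \<epsilon>) S u v) \<longlongrightarrow> dB_coeff N r core S u v) (at_right 0)"
proof -
  have w: "((\<lambda>\<epsilon>. weight \<epsilon> x y) \<longlongrightarrow> core x y) (at_right 0)" for x y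
    unfolding weight_def by (auto intro!: tendsto_eq_intros)
  have core: "wgraph N core" using wgraph_weight[of 0] by (simp add: weight_def[abs_def])
  have F: "0 < (\<Sum>x<N. fit r S x)" using assms by (intro fit_sum_pos) auto
  have Z: "0 < (\<Sum>x<N. fit r S x * core x v)"
    using assms core wdeg_core_pos by (intro fit_weight_sum_pos) auto
  show "((\<lambda>\<epsilon>. Bd_coeff N r (weight \<epsilon>) S u v) \<longlongrightarrow> Bd_coeff N r core S u v) (at_right 0)"
    unfolding Bd_coeff_def wdeg_def
    by (intro tendsto_intros w) (use F wdeg_core_pos[OF assms(2)] in \<open>simp add: wdeg_def\<close>)
  show "((\<lambda>\<epsilon>. dB_coeff N r (weight \<epsilon>) S u v) \<longlongrightarrow> dB_coeff N r core S u v) (at_right 0)"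
    unfolding dB_coeff_def
    by (intro tendsto_intros w) (use Z assms in simp)
qed

lemma coeff_core_pos:
  assumes "1 < r" "u < N" "v < N"
  shows "0 < Bd_coeff N r core S u v" "0 < dB_coeff N r core S u v"
proof -
  have core: "wgraph N core" using wgraph_weight[of 0] by (simp add: weight_def[abs_def])
  have F: "0 < (\<Sum>x<N. fit r S x)" using assms by (intro fit_sum_pos) auto
  have Z: "0 < (\<Sum>x<N. fit r S x * core x v)"
    using assms core wdeg_core_pos by (intro fit_weight_sum_pos) auto
  show "0 < Bd_coeff N r core S u v" using F wdeg_core_pos[OF assms(2)] assms
    by (simp add: Bd_coeff_def fit_pos)
  show "0 < dB_coeff N r core S u v" using Z assms
    by (simp add: dB_coeff_def fit_pos)
qed

lemma fit_hub_sum: "1 < r \<Longrightarrow> real L \<le> (\<Sum>x\<in>hub. fit r S x)"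
  using sum_mono[of hub "\<lambda>_. 1" "fit r S"] by (simp add: fit_def)

lemma dB_coeff_core:
  "v < N \<Longrightarrow> dB_coeff N r core S u v = fit r S u /
     (if v < 4 * q then fit r S (partner v) * pair_weight (v div 2) else (\<Sum>x\<in>hub. fit r S x) - fit r S v) / real N"
  by (simp only: dB_coeff_def sum_core divide_divide_eq_left mult.commute[of "real N"])

lemma Bd_coeff_core:
  "u < N \<Longrightarrow> Bd_coeff N r core S u v = fit r S u /
     (if u < 4 * q then pair_weight (u div 2) else real L - 1) / (\<Sum>x<N. fit r S x)"
  by (simp only: Bd_coeff_def wdeg_core divide_divide_eq_left mult.commute[of "\<Sum>x<N. fit r S x"])

context
  fixes r t :: real
  assumes r: "1 < r" "r < 6 / 5" and t: "t = (1 + 1 / r) / 2"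
    and W: "W = 10 * real L / (1 - t)" and small: "t ^ (L - 1) * (real L * W) < 49 / (4000 * real q)"
begin

lemma t_range: "0 < t" "t < 1" and tr: "t * r = (r + 1) / 2"
  using r by (auto simp: t field_simps)

lemma W_ge: "10 \<le> W" and Wt: "W * (1 - t) = 10 * real L"
proof -
  show *: "W * (1 - t) = 10 * real L" using t_range by (simp add: W)
  have "1 - t \<le> 1" "1 \<le> real L" using L_ge t_range by auto
  then have "1 - t \<le> real L" by (rule order.trans)
  then have "10 * (1 - t) \<le> W * (1 - t)" unfolding * by simp
  then show "10 \<le> W" by (rule mult_right_le_imp_le) (use t_range in simp)
qed

lemma inverse_W_sq_le: "1 / W\<^sup>2 \<le> 19 / 20"
proof -
  have "10\<^sup>2 \<le> W\<^sup>2" using W_ge by (intro power_mono) auto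
  then show ?thesis by (simp add: divide_simps)
qed

lemma pair_weight_range: "1 / W \<le> pair_weight p" "pair_weight p \<le> W"
proof -
  have "1 / W \<le> 1" using W_ge by simp
  then have "1 / W \<le> W" using W_ge by linarith
  then show "1 / W \<le> pair_weight p" "pair_weight p \<le> W"
    unfolding pair_weight_def by auto
qed

lemma small_Bd: "t ^ (L - 1) * (real L - 1) < pair_weight p * (49 / (4000 * real q))"
proof -
  have "t ^ (L - 1) * (real L - 1) \<le> t ^ (L - 1) * (real L * W) * (1 / W)"
    using t_range W_ge by simp
  also have "\<dots> < 49 / (4000 * real q) * (1 / W)"
    using small W_ge by (intro mult_strict_right_mono) auto
  also have "\<dots> \<le> 49 / (4000 * real q) * pair_weight p"
    using pair_weight_range by (intro mult_left_mono) auto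
  finally show ?thesis by (simp add: mult.commute)
qed

lemma small_dB: "t ^ (L - 1) * pair_weight p < (real L - 1) * (49 / (4000 * real q))"
proof -
  have "t ^ (L - 1) * pair_weight p \<le> t ^ (L - 1) * (real L * W)"
    using t_range pair_weight_range(2)[of p] W_ge L_ge
    by (intro mult_left_mono order.trans[OF _ mult_right_mono[of 1 "real L" W]]) auto
  also have "\<dots> < 1 * (49 / (4000 * real q))" using small by simp
  also have "\<dots> \<le> (real L - 1) * (49 / (4000 * real q))"
    using L_ge by (intro mult_right_mono) auto
  finally show ?thesis .
qed

lemma eventually_fixation_Bd_ge:
  "\<forall>\<^sub>F \<epsilon> in at_right 0. \<forall>S\<subseteq>{..<N}.
     potential (\<lambda>p. if p < q then 1 / W\<^sup>2 else 19 / 20) t S \<le> fixation (Bd_step N (weight \<epsilon>) r) N S"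
proof -
  let ?lam = "\<lambda>p. if p < q then 1 / W\<^sup>2 else 19 / 20"
  interpret hub_potential q L W ?lam t
    by unfold_locales (use t_range inverse_W_sq_le W_pos in auto)
  have L1: "0 < real L - 1" using L_ge by simp
  have F: "0 < (\<Sum>x<N. fit r S x)" for S using r L_ge by (intro fit_sum_pos) auto
  show ?thesis
  proof (rule eventually_fixation_ge[where c = "Bd_coeff N r core"])
    show "edge_chain N (Bd_step N (weight \<epsilon>) r) (\<lambda>S u v. Bd_coeff N r (weight \<epsilon>) S u v * weight \<epsilon> u v)"
      if "0 < \<epsilon>" for \<epsilon>
      using r that L_ge by (intro edge_chain_Bd wgraph_weight wdeg_weight_pos) auto
    show "((\<lambda>\<epsilon>. Bd_coeff N r (weight \<epsilon>) S u v) \<longlongrightarrow> Bd_coeff N r core S u v) (at_right 0)"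
      "0 < Bd_coeff N r core S u v" if "u < N" "v < N" for S u v
      using coeff_limits coeff_core_pos that r by auto
    fix S u v
    show "Bd_coeff N r core S v u < t * Bd_coeff N r core S u v"
      if "u \<in> hub" "v \<in> hub" "u \<in> S" "v \<notin> S"
    proof -
      have "1 / (real L - 1) / (\<Sum>x<N. fit r S x) < t * r / (real L - 1) / (\<Sum>x<N. fit r S x)"
        using F L1 r unfolding tr by (intro divide_strict_right_mono) auto
      then show ?thesis using that by (simp add: Bd_coeff_core fit_def[of r S u] fit_def[of r S v])
    qed
    show "Bd_coeff N r core S (partner u) u \<le> Bd_coeff N r core S u (partner u)"
      if "u < 4 * q" "u \<in> S" "partner u \<notin> S"
    proof -
      have "1 / pair_weight (u div 2) / (\<Sum>x<N. fit r S x) \<le> r / pair_weight (u div 2) / (\<Sum>x<N. fit r S x)"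
        using F[of S] pair_weight_pos[of "u div 2"] r by (intro divide_right_mono) auto
      then show ?thesis
        using that partner_less[OF that(1)] partner_div[of u]
        by (simp add: Bd_coeff_core fit_def[of r S u] fit_def[of r S "partner u"])
    qed
    show "Bd_coeff N r core S v u * ?lam (u div 2) < Bd_coeff N r core S u v * ((1 - t) / 10)"
      if "S \<inter> hub = {}" "u < 4 * q" "u \<in> S" "partner u \<in> S" "v \<in> hub"
    proof -
      have v: "v \<notin> S" using that by auto
      define p where "p = u div 2"
      have "?lam p * pair_weight p \<le> 1 / W"
        using W_ge by (simp add: pair_weight_def power2_eq_square divide_simps)
      then have "?lam p * pair_weight p * 10 \<le> 10 / W" by simp
      also have "10 / W = (1 - t) / real L" using Wt W_pos L_ge by (simp add: frac_eq_eq mult.commute)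
      also have "\<dots> \<le> 1 * (1 - t) * 1" using L_ge t_range by (simp add: divide_simps)
      also have "\<dots> < r * (1 - t) * (real L - 1)"
        by (rule mult_strict_mono) (use mult_strict_right_mono[OF r(1), of "1 - t"] r t_range L_ge in auto)
      finally have "?lam p / (real L - 1) < r / pair_weight p * ((1 - t) / 10)"
        using L1 pair_weight_pos[of p] by (simp add: divide_simps mult_ac)
      from divide_strict_right_mono[OF this F]
      have "?lam p / (real L - 1) / (\<Sum>x<N. fit r S x) < r / pair_weight p * ((1 - t) / 10) / (\<Sum>x<N. fit r S x)" .
      moreover have "Bd_coeff N r core S u v = r / pair_weight p / (\<Sum>x<N. fit r S x)"
        "Bd_coeff N r core S v u = 1 / (real L - 1) / (\<Sum>x<N. fit r S x)"
        using that v by (simp_all add: Bd_coeff_core p_def fit_def[of r S u] fit_def[of r S v])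
      moreover have "1 / (real L - 1) / (\<Sum>x<N. fit r S x) * ?lam p = ?lam p / (real L - 1) / (\<Sum>x<N. fit r S x)"
        "r / pair_weight p / (\<Sum>x<N. fit r S x) * ((1 - t) / 10)
          = r / pair_weight p * ((1 - t) / 10) / (\<Sum>x<N. fit r S x)" by simp_all
      ultimately show ?thesis unfolding p_def[symmetric] by (simp only:)
    qed
    show "Bd_coeff N r core S v u * t ^ (L - 1) < Bd_coeff N r core S u v * (49 / (4000 * real q))"
      if "hub \<subseteq> S" "v < 4 * q" "v \<notin> S" "partner v \<notin> S" "u \<in> hub"
    proof -
      have u: "u \<in> S" using that by auto
      define k where "k = 49 / (4000 * real q)"
      have k: "0 < k" using q_pos by (simp add: k_def)
      have "t ^ (L - 1) * (real L - 1) < pair_weight (v div 2) * k"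
        using small_Bd unfolding k_def .
      also have "\<dots> \<le> r * (pair_weight (v div 2) * k)"
        using r k pair_weight_pos[of "v div 2"] by simp
      finally have "t ^ (L - 1) / pair_weight (v div 2) < r / (real L - 1) * k"
        using L1 pair_weight_pos[of "v div 2"] by (simp add: divide_simps mult_ac)
      from divide_strict_right_mono[OF this F]
      have "t ^ (L - 1) / pair_weight (v div 2) / (\<Sum>x<N. fit r S x) < r / (real L - 1) * k / (\<Sum>x<N. fit r S x)" .
      moreover have "Bd_coeff N r core S u v = r / (real L - 1) / (\<Sum>x<N. fit r S x)"
        "Bd_coeff N r core S v u = 1 / pair_weight (v div 2) / (\<Sum>x<N. fit r S x)"
        using that u by (simp_all add: Bd_coeff_core fit_def[of r S u] fit_def[of r S v])
      ultimately show ?thesis unfolding k_def[symmetric] by simp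
    qed
  qed
qed

lemma eventually_fixation_dB_ge:
  "\<forall>\<^sub>F \<epsilon> in at_right 0. \<forall>S\<subseteq>{..<N}.
     potential (\<lambda>p. if p < q then 19 / 20 else 1 / W\<^sup>2) t S \<le> fixation (dB_step N (weight \<epsilon>) r) N S"
proof -
  let ?lam = "\<lambda>p. if p < q then 19 / 20 else 1 / W\<^sup>2"
  interpret hub_potential q L W ?lam t
    by unfold_locales (use t_range inverse_W_sq_le W_pos in auto)
  have L1: "0 < real L - 1" using L_ge by simp
  have N: "0 < real N" using L_ge by simp
  have rr: "1 \<le> r * r" using mult_mono[of 1 r 1 r] r by simp
  show ?thesis
  proof (rule eventually_fixation_ge[where c = "dB_coeff N r core"])
    show "edge_chain N (dB_step N (weight \<epsilon>) r) (\<lambda>S u v. dB_coeff N r (weight \<epsilon>) S u v * weight \<epsilon> u v)"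
      if "0 < \<epsilon>" for \<epsilon>
      using r that L_ge by (intro edge_chain_dB wgraph_weight wdeg_weight_pos) auto
    show "((\<lambda>\<epsilon>. dB_coeff N r (weight \<epsilon>) S u v) \<longlongrightarrow> dB_coeff N r core S u v) (at_right 0)"
      "0 < dB_coeff N r core S u v" if "u < N" "v < N" for S u v
      using coeff_limits coeff_core_pos that r by auto
    fix S u v
    show "dB_coeff N r core S v u < t * dB_coeff N r core S u v"
      if "u \<in> hub" "v \<in> hub" "u \<in> S" "v \<notin> S"
    proof -
      define Z where "Z = (\<Sum>x\<in>hub. fit r S x)"
      have Z: "4 \<le> Z" using fit_hub_sum[OF r(1), of S] L_ge by (simp add: Z_def)
      have "0 < (r - 1) * (Z - (r + 2)) / 2" using r Z by simp
      also have "\<dots> = (r + 1) / 2 * (Z - r) - (Z - 1)" by (simp add: field_simps)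
      finally have "Z - 1 < t * r * (Z - r)" unfolding tr by simp
      then have "1 / (Z - r) < t * r / (Z - 1)" using r Z by (simp add: divide_simps)
      then have "1 / (Z - r) / real N < t * r / (Z - 1) / real N" using N by (rule divide_strict_right_mono)
      moreover have "dB_coeff N r core S u v = r / (Z - 1) / real N" "dB_coeff N r core S v u = 1 / (Z - r) / real N"
        using that by (simp_all add: dB_coeff_core fit_def[of r S u] fit_def[of r S v] Z_def)
      ultimately show ?thesis by simp
    qed
    show "dB_coeff N r core S (partner u) u \<le> dB_coeff N r core S u (partner u)"
      if "u < 4 * q" "u \<in> S" "partner u \<notin> S"
    proof -
      have "partner (partner u) = u" using partner_iff[of u "partner u"] partner_div[of u] by auto
      then show ?thesis
        using that partner_less[OF that(1)] partner_div[of u] r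
        by (simp add: dB_coeff_core fit_def[of r S u] fit_def[of r S "partner u"])
    qed
    show "dB_coeff N r core S v u * ?lam (u div 2) < dB_coeff N r core S u v * ((1 - t) / 10)"
      if "S \<inter> hub = {}" "u < 4 * q" "u \<in> S" "partner u \<in> S" "v \<in> hub"
    proof -
      have v: "v \<notin> S" using that by auto
      have Z: "(\<Sum>x\<in>hub. fit r S x) = real L"
        using that(1) by (subst sum.cong[of hub hub _ "\<lambda>_. 1"]) (auto simp: fit_def)
      define p where "p = u div 2"
      have lam: "?lam p * W \<le> pair_weight p"
        using W_ge by (simp add: pair_weight_def power2_eq_square)
      have "?lam p * (10 * (real L - 1)) < ?lam p * (10 * real L)"
        using W_ge by (intro mult_strict_left_mono) auto
      also have "\<dots> = ?lam p * W * (1 - t)" unfolding Wt[symmetric] by (simp only: mult.assoc)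
      also have "\<dots> \<le> pair_weight p * (1 - t)" using lam t_range by (intro mult_right_mono) auto
      also have "\<dots> \<le> (r * r) * (pair_weight p * (1 - t))"
        using mult_right_mono[OF rr, of "pair_weight p * (1 - t)"] pair_weight_pos[of p] t_range by simp
      finally have "?lam p / (r * pair_weight p) < r / (real L - 1) * ((1 - t) / 10)"
        using r L1 pair_weight_pos[of p] by (simp add: divide_simps mult_ac)
      then have "?lam p / (r * pair_weight p) / real N < r / (real L - 1) * ((1 - t) / 10) / real N"
        using N by (rule divide_strict_right_mono)
      moreover have "dB_coeff N r core S u v = r / (real L - 1) / real N"
        "dB_coeff N r core S v u = 1 / (r * pair_weight p) / real N"
        using that v
        by (simp_all add: dB_coeff_core Z p_def fit_def[of r S u] fit_def[of r S v] fit_def[of r S "partner u"])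
      moreover have "1 / (r * pair_weight p) / real N * ?lam p = ?lam p / (r * pair_weight p) / real N"
        "r / (real L - 1) / real N * ((1 - t) / 10) = r / (real L - 1) * ((1 - t) / 10) / real N" by simp_all
      ultimately show ?thesis unfolding p_def[symmetric] by (simp only:)
    qed
    show "dB_coeff N r core S v u * t ^ (L - 1) < dB_coeff N r core S u v * (49 / (4000 * real q))"
      if "hub \<subseteq> S" "v < 4 * q" "v \<notin> S" "partner v \<notin> S" "u \<in> hub"
    proof -
      have u: "u \<in> S" using that by auto
      have Z: "(\<Sum>x\<in>hub. fit r S x) - r = r * (real L - 1)"
        using that(1) by (subst sum.cong[of hub hub _ "\<lambda>_. r"]) (auto simp: fit_def algebra_simps)
      define k where "k = 49 / (4000 * real q)"
      have k: "0 < k" using q_pos by (simp add: k_def)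
      have "t ^ (L - 1) * pair_weight (v div 2) < (real L - 1) * k"
        using small_dB unfolding k_def .
      also have "\<dots> \<le> (r * r) * ((real L - 1) * k)"
        using mult_right_mono[OF rr, of "(real L - 1) * k"] k L1 by simp
      finally have "t ^ (L - 1) / (r * (real L - 1)) < r / pair_weight (v div 2) * k"
        using r L1 pair_weight_pos[of "v div 2"] by (simp add: divide_simps mult_ac)
      then have "t ^ (L - 1) / (r * (real L - 1)) / real N < r / pair_weight (v div 2) * k / real N"
        using N by (rule divide_strict_right_mono)
      moreover have "dB_coeff N r core S u v = r / pair_weight (v div 2) / real N"
        "dB_coeff N r core S v u = 1 / (r * (real L - 1)) / real N"
        using that u Z
        by (simp_all add: dB_coeff_core fit_def[of r S u] fit_def[of r S v] fit_def[of r S "partner v"])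
      ultimately show ?thesis unfolding k_def[symmetric] by simp
    qed
  qed
qed

lemma rho_ge_of_potential:
  assumes lam: "\<And>p. 0 < lam p" "\<And>p. lam p \<le> 19 / 20"
    and chain: "edge_chain N step P"
    and ge: "\<And>S. S \<subseteq> {..<N} \<Longrightarrow> potential lam t S \<le> fixation step N S"
    and A: "A \<subseteq> {..<4 * q}" "\<And>v. v \<in> A \<Longrightarrow> lam (v div 2) = 19 / 20"
  shows "15827 / 40000 * real (card A) / real N \<le> rho step N"
proof -
  interpret hub_potential q L W lam t
    by unfold_locales (use t_range lam in auto)
  have "(\<Sum>v\<in>A. 15827 / 40000) \<le> (\<Sum>v\<in>A. fixation step N {v})"
  proof (rule sum_mono)
    fix v assume v: "v \<in> A"
    then have "v < 4 * q" using A by auto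
    then show "15827 / 40000 \<le> fixation step N {v}"
      using ge[of "{v}"] potential_single_pair[of v] A(2)[OF v] by simp
  qed
  also have "\<dots> \<le> (\<Sum>v<N. fixation step N {v})"
    using A fixation_nonneg[OF chain] by (intro sum_mono2) auto
  finally have "15827 / 40000 * real (card A) \<le> (\<Sum>v<N. fixation step N {v})" by simp
  from divide_right_mono[OF this, of "real N"] show ?thesis by (simp add: rho_def)
qed

lemma ex_weight_rho_ge:
  "\<exists>\<epsilon>>0. 15827 / 40000 * real (2 * q) / real N \<le> rho_Bd r N (weight \<epsilon>)
     \<and> 15827 / 40000 * real (2 * q) / real N \<le> rho_dB r N (weight \<epsilon>)"
proof -
  have "\<forall>\<^sub>F \<epsilon> in at_right 0. 0 < \<epsilon> \<and>
     (\<forall>S\<subseteq>{..<N}. potential (\<lambda>p. if p < q then 1 / W\<^sup>2 else 19 / 20) t S \<le> fixation (Bd_step N (weight \<epsilon>) r) N S) \<and>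
     (\<forall>S\<subseteq>{..<N}. potential (\<lambda>p. if p < q then 19 / 20 else 1 / W\<^sup>2) t S \<le> fixation (dB_step N (weight \<epsilon>) r) N S)"
    by (intro eventually_conj eventually_at_right_less eventually_fixation_Bd_ge eventually_fixation_dB_ge)
  then obtain \<epsilon> :: real where \<epsilon>: "0 < \<epsilon>"
    and Bd: "\<And>S. S \<subseteq> {..<N} \<Longrightarrow> potential (\<lambda>p. if p < q then 1 / W\<^sup>2 else 19 / 20) t S \<le> fixation (Bd_step N (weight \<epsilon>) r) N S"
    and dB: "\<And>S. S \<subseteq> {..<N} \<Longrightarrow> potential (\<lambda>p. if p < q then 19 / 20 else 1 / W\<^sup>2) t S \<le> fixation (dB_step N (weight \<epsilon>) r) N S"
    using eventually_happens'[OF trivial_limit_at_right_real] by blast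
  have "15827 / 40000 * real (card {2 * q..<4 * q}) / real N \<le> rho_Bd r N (weight \<epsilon>)"
    unfolding rho_Bd_def
  proof (rule rho_ge_of_potential[OF _ _ edge_chain_Bd Bd])
    show "(if v div 2 < q then 1 / W\<^sup>2 else 19 / 20) = 19 / 20" if "v \<in> {2 * q..<4 * q}" for v
      using that by auto
  qed (use r \<epsilon> L_ge W_pos inverse_W_sq_le wgraph_weight wdeg_weight_pos in auto)
  moreover have "15827 / 40000 * real (card {..<2 * q}) / real N \<le> rho_dB r N (weight \<epsilon>)"
    unfolding rho_dB_def
  proof (rule rho_ge_of_potential[OF _ _ edge_chain_dB dB])
    show "(if v div 2 < q then 19 / 20 else 1 / W\<^sup>2) = 19 / 20" if "v \<in> {..<2 * q}" for v
      using that by auto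
  qed (use r \<epsilon> L_ge W_pos inverse_W_sq_le wgraph_weight wdeg_weight_pos in auto)
  ultimately show ?thesis using \<epsilon> by (intro exI[of _ \<epsilon>]) simp
qed

end

end

lemma cube_times_power_tendsto_0:
  fixes t :: real
  assumes "0 < t" "t < 1"
  shows "(\<lambda>n. real n ^ 3 * t ^ n) \<longlonglongrightarrow> 0"
proof -
  have "norm (root 3 t) < 1" using assms by simp
  then have "(\<lambda>n. (real n * root 3 t ^ n) ^ 3) \<longlonglongrightarrow> 0 ^ 3"
    by (intro tendsto_power powser_times_n_limit_0)
  moreover have "(real n * root 3 t ^ n) ^ 3 = real n ^ 3 * t ^ n" for n
  proof -
    have "(root 3 t ^ n) ^ 3 = (root 3 t ^ 3) ^ n" by (simp only: power_mult[symmetric] mult.commute)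
    then show ?thesis using assms by (simp add: power_mult_distrib)
  qed
  ultimately show ?thesis by simp
qed

theorem theorem4:
  shows "\<forall>r::real. 1 < r \<and> r < 1.2 \<longrightarrow>
    (\<exists>N0::nat. \<forall>N\<ge>N0. \<exists>w. connected_wgraph N w \<and>
       rho_Bd r N w > 1.04 * rho_Bd r N complete_graph \<and>
       rho_dB r N w > 1.04 * rho_dB r N complete_graph)"
proof (intro allI impI)
  fix r :: real
  assume "1 < r \<and> r < 1.2"
  then have r: "1 < r" "r < 6 / 5" by auto
  define t where "t = (1 + 1 / r) / 2"
  have t: "0 < t" "t < 1" using r by (auto simp: t_def field_simps)
  have "\<forall>\<^sub>F n in sequentially. real n ^ 3 * t ^ n < 49 * t * (1 - t) / 240000"
    using cube_times_power_tendsto_0[OF t] t by (intro order_tendstoD(2)) auto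
  then obtain L0 where L0: "\<And>n. L0 \<le> n \<Longrightarrow> real n ^ 3 * t ^ n < 49 * t * (1 - t) / 240000"
    unfolding eventually_sequentially by blast
  have "\<forall>\<^sub>F n in sequentially. (1 / r) ^ n < 1 / 100"
    using r by (intro order_tendstoD(2)[OF LIMSEQ_power_zero]) auto
  then obtain N1 where N1: "\<And>n. N1 \<le> n \<Longrightarrow> (1 / r) ^ n < 1 / 100"
    unfolding eventually_sequentially by blast
  show "\<exists>N0::nat. \<forall>N\<ge>N0. \<exists>w. connected_wgraph N w \<and>
       rho_Bd r N w > 1.04 * rho_Bd r N complete_graph \<and>
       rho_dB r N w > 1.04 * rho_dB r N complete_graph"
  proof (rule exI[of _ "max (max 100 N1) (25 * L0)"], intro allI impI)
    fix N assume N: "max (max 100 N1) (25 * L0) \<le> N"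
    define q where "q = 6 * N div 25"
    define L where "L = N - 4 * q"
    define W where "W = 10 * real L / (1 - t)"
    have NL: "N = 4 * q + L" and q: "0 < q" "23 * N \<le> 100 * q" "q \<le> 6 * L" and L: "4 \<le> L" "L0 \<le> L"
      using N unfolding q_def L_def by auto
    have "t ^ (L - 1) * (real L * W) * real q < 49 / 4000"
    proof -
      have "t ^ (L - 1) * (real L * W) * real q \<le> t ^ (L - 1) * (real L * W) * (6 * real L)"
        using q t by (intro mult_left_mono) (auto simp: W_def)
      also have "\<dots> = 60 * (real L ^ 3 * t ^ L) / (t * (1 - t))"
        using t L power_eq_if[of t L] by (simp add: W_def power3_eq_cube)
      also have "\<dots> < 49 / 4000"
        using L0[OF L(2)] t by (simp add: divide_simps)
      finally show ?thesis .
    qed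
    then have small: "t ^ (L - 1) * (real L * W) < 49 / (4000 * real q)"
      using q by (simp add: divide_simps mult_ac)
    interpret hub_pairs q L W
      by unfold_locales (use q L t in \<open>auto simp: W_def\<close>)
    obtain \<epsilon> where \<epsilon>: "0 < \<epsilon>" "15827 / 40000 * real (2 * q) / real N \<le> rho_Bd r N (weight \<epsilon>)"
      "15827 / 40000 * real (2 * q) / real N \<le> rho_dB r N (weight \<epsilon>)"
      using ex_weight_rho_ge[OF r t_def W_def small] unfolding NL by blast
    have "23 * real N \<le> 100 * real q" using q(2) by linarith
    then have big: "18 / 100 < 15827 / 40000 * real (2 * q) / real N"
      using N by (simp add: divide_simps)
    have "1 - 1 / r \<le> 1 / 6" using r by (simp add: field_simps)
    moreover have "(1 / r) ^ N < 1 / 100" using N N1 by simp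
    ultimately have "(1 - 1 / r) / (1 - (1 / r) ^ N) \<le> (1 / 6) / (99 / 100)"
      using r by (intro frac_le) auto
    then have "rho_Bd r N complete_graph \<le> (1 / 6) / (99 / 100)" "rho_dB r N complete_graph \<le> (1 / 6) / (99 / 100)"
      using N by (intro order.trans[OF rho_Bd_complete_graph_le[OF r(1)]] order.trans[OF rho_dB_complete_graph_le[OF r(1)]]; simp)+
    then have "1.04 * rho_Bd r N complete_graph < 18 / 100" "1.04 * rho_dB r N complete_graph < 18 / 100"
      by simp_all
    then show "\<exists>w. connected_wgraph N w \<and>
       rho_Bd r N w > 1.04 * rho_Bd r N complete_graph \<and>
       rho_dB r N w > 1.04 * rho_dB r N complete_graph"
      using \<epsilon> big connected_weight[OF \<epsilon>(1)] unfolding NL[symmetric]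
      by (intro exI[of _ "weight \<epsilon>"]) linarith
  qed
qed

end
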